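(* For $n\ge1$ and $t\in\mathfrak T_{2n+1}$ put $\mathrm{Eoc}(t)=\mathrm{eoc}(t)$ and $\mathrm{Pom}(t)=2n+1-\mathrm{pom}(t)$, and let $\mathfrak T_{2n+1}(x,y)=\sum_{t\in\mathfrak T_{2n+1}}x^{\mathrm{Eoc}(t)}y^{\mathrm{Pom}(t)}$. Then $\mathfrak T_{2n+1}(x,y)=\mathfrak T_{2n+1}(y,x)$.
   Context: A strictly ordered binary tree on $N$ vertices is a rooted tree whose vertices are labeled bijectively by $1,\dots,N$, the root being labeled $1$, in which every vertex has either no child (a leaf) or exactly two children (their order is immaterial), and labels increase along every path from the root. $\mathfrak T_{2n+1}$ denotes the set of these trees on $2n+1$ vertices. For $t\in\mathfrak T_{2n+1}$ ($n\ge1$): the minimal chain starts at the root and repeatedly moves to the child with the smaller label until a leaf is reached; $\mathrm{eoc}(t)$ is the label of that leaf. The vertex $2n+1$ is a leaf, and $\mathrm{pom}(t)$ is the label of its parent. *)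

theory Defs
  imports Main "HOL-Library.While_Combinator"
begin

text \<open>
  Vertices are identified with their labels. A rooted tree is given by its set of arcs
  \<open>(parent, child)\<close>, so that \<open>E `` {v}\<close> is the unordered set of children of \<open>v\<close>.
\<close>

definition rooted_tree :: "'v set \<Rightarrow> 'v \<Rightarrow> ('v \<times> 'v) set \<Rightarrow> bool" where
  "rooted_tree V r E \<longleftrightarrow>
     r \<in> V \<and> E \<subseteq> V \<times> V \<and>
     (\<forall>u. (u, r) \<notin> E) \<and>
     (\<forall>v \<in> V - {r}. \<exists>!u. (u, v) \<in> E) \<and>
     (\<forall>v \<in> V. (r, v) \<in> E\<^sup>*)"

definition so_binary_trees :: "nat \<Rightarrow> (nat \<times> nat) set set" where
  "so_binary_trees N =
     {E. rooted_tree {1..N} 1 E \<and>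
         (\<forall>v \<in> {1..N}. E `` {v} = {} \<or> card (E `` {v}) = 2) \<and>
         (\<forall>u v. (u, v) \<in> E\<^sup>+ \<longrightarrow> u < v)}"

definition eoc :: "(nat \<times> nat) set \<Rightarrow> nat" where
  "eoc E = while (\<lambda>v. E `` {v} \<noteq> {}) (\<lambda>v. Min (E `` {v})) 1"

definition pom :: "nat \<Rightarrow> (nat \<times> nat) set \<Rightarrow> nat" where
  "pom n E = (THE u. (u, 2 * n + 1) \<in> E)"

definition Eoc :: "(nat \<times> nat) set \<Rightarrow> nat" where
  "Eoc E = eoc E"

text \<open>The subtraction never truncates for trees on \<open>2 * n + 1\<close> vertices with \<open>n \<ge> 1\<close>,
  since then \<open>pom n E < 2 * n + 1\<close>.\<close>

definition Pom :: "nat \<Rightarrow> (nat \<times> nat) set \<Rightarrow> nat" where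
  "Pom n E = 2 * n + 1 - pom n E"

text \<open>
  The type variable ranges over all commutative semirings, in particular over polynomial
  rings; taking \<open>x\<close> and \<open>y\<close> to be the two indeterminates of \<open>\<int>[x,y]\<close> (e.g. as
  \<open>int poly poly\<close>) gives the formal generating polynomial.
\<close>

definition tree_poly :: "nat \<Rightarrow> 'a::comm_semiring_1 \<Rightarrow> 'a \<Rightarrow> 'a" where
  "tree_poly n x y = (\<Sum>E \<in> so_binary_trees (2 * n + 1). x ^ Eoc E * y ^ Pom n E)"

end

theory Submission
  imports Defs Complex_Main
begin

text \<open>
  Read the labels of a tree on \<open>N\<close> vertices from \<open>N\<close> down to \<open>1\<close>: a label either is a leaf or joins
  two of the \<open>h\<close> current roots, so completions of a partial tree are counted by powers of the operator
  \<open>(A f) h = f (h + 1) + binom(h, 2) f (h - 1)\<close>, \<open>A = U + D\<close>. Following the leaf that ends the minimal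
  chain (together with the sibling of its current chain vertex) and the root status of \<open>N\<close>, the
  number of trees with \<open>eoc = m\<close> and \<open>pom = k\<close> is \<open>(A^p K A^q e) 1\<close>, where \<open>e\<close> is the indicator of \<open>1\<close>.
  With \<open>(\<theta> f) h = h f h\<close>, for \<open>m < k\<close> one has \<open>p = N - 2 - k\<close>, \<open>q = m - 2\<close>, \<open>K = \<theta> A^(k-m-1) \<theta>\<close>;
  for \<open>k < m\<close> one has \<open>p = N - 2 - m\<close>, \<open>q = k - 2\<close> and, with \<open>a = m - k - 1 > 0\<close>,
  \<open>K = \<theta> A^a \<theta> - \<theta> A^(a-1) (U - D) + (U - D) A^(a-1) \<theta>\<close>. For a suitable weighted inner product \<open>U\<close> and \<open>D\<close>
  are adjoint and \<open>\<theta>\<close> is self-adjoint, hence so are \<open>A\<close> and \<open>K\<close>. Exchanging \<open>p\<close> and \<open>q\<close> therefore does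
  not change the number, and this is the substitution \<open>(m, k) \<mapsto> (N - k, N - m)\<close>.
\<close>

section \<open>Operators on weights\<close>

text \<open>
  Identifying \<open>f\<close> with the exponential generating function of \<open>f h\<close> in a variable \<open>z\<close>, \<open>up\<close> is \<open>d/dz\<close>,
  \<open>mulz\<close> is multiplication by \<open>z\<close>, \<open>shift\<close> is integration from \<open>0\<close>, \<open>euler = z d/dz\<close> and
  \<open>step = (1 + z^2/2) d/dz\<close>. In the notation above \<open>U\<close>, \<open>D\<close>, \<open>A\<close>, \<open>\<theta>\<close>, \<open>K\<close> are \<open>up\<close>, \<open>down\<close>, \<open>step\<close>,
  \<open>euler\<close>, \<open>mid a\<close>.
\<close>

type_synonym weight = "nat \<Rightarrow> rat"

definition up :: "weight \<Rightarrow> weight" where "up f h = f (Suc h)"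
definition down :: "weight \<Rightarrow> weight" where "down f h = of_nat (h choose 2) * f (h - 1)"
definition step :: "weight \<Rightarrow> weight" where "step f h = f (Suc h) + of_nat (h choose 2) * f (h - 1)"
definition euler :: "weight \<Rightarrow> weight" where "euler f h = of_nat h * f h"
definition shift :: "weight \<Rightarrow> weight" where "shift f h = (if h = 0 then 0 else f (h - 1))"
definition mulz :: "weight \<Rightarrow> weight" where "mulz f h = of_nat h * f (h - 1)"
definition unit :: "nat \<Rightarrow> weight" where "unit j h = (if h = j then 1 else 0)"

lemma of_nat_choose_two: "of_nat (h choose 2) = (of_nat h * (of_nat h - 1) / 2 :: rat)"
proof -
  have "even (h * (h - 1))" by (cases h) auto
  then have "2 * (h choose 2) = h * (h - 1)"
    by (simp add: choose_two)
  then have "2 * of_nat (h choose 2) = (of_nat (h * (h - 1)) :: rat)"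
    by (metis of_nat_mult of_nat_numeral)
  then show ?thesis by (cases h) (auto simp: algebra_simps)
qed

section \<open>Linearity of \<open>step\<close> and commutation with its powers\<close>

lemma step_add: "step (\<lambda>h. f h + g h) = (\<lambda>h. step f h + step g h)"
  by (simp add: step_def fun_eq_iff algebra_simps)

lemma step_diff: "step (\<lambda>h. f h - g h) = (\<lambda>h. step f h - step g h)"
  by (simp add: step_def fun_eq_iff algebra_simps)

lemma step_pow_diff: "(step ^^ a) (\<lambda>h. f h - g h) = (\<lambda>h. (step ^^ a) f h - (step ^^ a) g h)"
  by (induction a) (simp_all add: step_diff)

lemma step_pow_add: "(step ^^ a) (\<lambda>h. f h + g h) = (\<lambda>h. (step ^^ a) f h + (step ^^ a) g h)"
  by (induction a) (simp_all add: step_add)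

lemma step_pow_Suc: "(step ^^ Suc a) f = (step ^^ a) (step f)"
  by (simp add: funpow_swap1)

text \<open>Unfolded with A = \<open>step\<close>, this is the sum over j < a of A^(a-1-j)
  \<open>shift\<close> A^j f: the accumulated inhomogeneous terms of the recursion
  \<open>open_val_Suc\<close>.\<close>

primrec shift_sum :: "nat \<Rightarrow> weight \<Rightarrow> weight" where
  "shift_sum 0 f = (\<lambda>h. 0)"
| "shift_sum (Suc a) f = (\<lambda>h. step (shift_sum a f) h + shift ((step ^^ a) f) h)"

text \<open>In the differential picture z is the derivative of 1 + z^2/2, which gives the commutator
  of d/dz and \<open>step\<close>.\<close>

lemma up_step: "up (step f) h = step (up f) h + mulz (up f) h"
  by (cases h) (simp_all add: up_def step_def mulz_def of_nat_choose_two algebra_simps add_divide_distrib diff_divide_distrib)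

text \<open>The outer derivative undoes the integration in \<open>shift\<close>. Both sides then
  obey the same recursion in \<open>a\<close>, by \<open>up_step\<close> and the rule A(z g') = z A
  g' + A g.\<close>

lemma up_shift_sum:
  "up (shift_sum (Suc a) f) = (\<lambda>h. up ((step ^^ a) (mulz f)) h - mulz (up ((step ^^ a) f)) h)"
proof (induction a)
  case 0
  show ?case
  proof
    fix h show "up (shift_sum (Suc 0) f) h = up ((step ^^ 0) (mulz f)) h - mulz (up ((step ^^ 0) f)) h"
      by (cases h) (simp_all add: up_def step_def mulz_def shift_def algebra_simps)
  qed
next
  case (Suc a)
  define F G where "F = (step ^^ a) (mulz f)" and "G = (step ^^ a) f"
  show ?case
  proof
    fix h
    have "up (shift_sum (Suc (Suc a)) f) h = up (step (shift_sum (Suc a) f)) h + step G h"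
      by (simp add: up_def shift_def G_def)
    also have "up (step (shift_sum (Suc a) f)) h
        = step (\<lambda>h. up F h - mulz (up G) h) h + mulz (\<lambda>h. up F h - mulz (up G) h) h"
      unfolding up_step Suc F_def G_def ..
    also have "\<dots> + step G h = up (step F) h - mulz (up (step G)) h"
    proof -
      \<comment> \<open>Splitting off 0 and 1 resolves the nested truncated subtractions.\<close>
      consider "h = 0" | "h = 1" | j where "h = Suc (Suc j)"
        by (metis One_nat_def not0_implies_Suc)
      then show ?thesis
        by cases (simp_all add: up_def step_def mulz_def of_nat_choose_two algebra_simps add_divide_distrib diff_divide_distrib)
    qed
    finally show "up (shift_sum (Suc (Suc a)) f) h =
        up ((step ^^ Suc a) (mulz f)) h - mulz (up ((step ^^ Suc a) f)) h"
      by (simp add: F_def G_def)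
  qed
qed

text \<open>Multiply \<open>up_shift_sum\<close> by z. Since \<open>down\<close> is (z^2/2) d/dz,
  both z * \<open>euler\<close> f and z^2 d/dz f are twice \<open>down\<close> f, so the whole sum
  collapses to two terms.\<close>

lemma euler_shift_sum:
  "euler (shift_sum (Suc a) (euler f)) h =
     2 * euler ((step ^^ a) (down f)) h - 2 * down ((step ^^ a) (euler f)) h"
proof -
  have *: "euler g h = mulz (up g) h" "2 * down g h = mulz (mulz (up g)) h" for g h
    by (cases h; cases "h - 1"; simp add: euler_def mulz_def up_def down_def of_nat_choose_two)+
  have **: "mulz (euler f) = (\<lambda>h. down f h + down f h)"
  proof
    fix h show "mulz (euler f) h = down f h + down f h"
      by (cases h) (simp_all add: euler_def mulz_def down_def of_nat_choose_two)
  qed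
  have "euler (shift_sum (Suc a) (euler f)) h
      = mulz (\<lambda>h. up ((step ^^ a) (mulz (euler f))) h - mulz (up ((step ^^ a) (euler f))) h) h"
    unfolding *(1) up_shift_sum ..
  also have "\<dots> = mulz (up ((step ^^ a) (mulz (euler f)))) h - mulz (mulz (up ((step ^^ a) (euler f)))) h"
    by (simp add: mulz_def algebra_simps)
  also have "mulz (up ((step ^^ a) (mulz (euler f)))) h = 2 * euler ((step ^^ a) (down f)) h"
    unfolding ** step_pow_add by (simp add: *(1)[symmetric] euler_def algebra_simps)
  finally show ?thesis unfolding *(2)[symmetric] .
qed

section \<open>An inner product making \<open>up\<close> and \<open>down\<close> adjoint\<close>

text \<open>These weights are forced by requiring \<open>up\<close> and \<open>down\<close> to be adjoint to each other.\<close>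

fun norm_weight :: weight where
  "norm_weight 0 = 0"
| "norm_weight (Suc 0) = 1"
| "norm_weight (Suc (Suc h)) = norm_weight (Suc h) / of_nat (Suc (Suc h) choose 2)"

lemma norm_weight_Suc: "norm_weight (Suc h) * of_nat (Suc h choose 2) = norm_weight h"
proof (cases h)
  case (Suc j)
  have "(Suc (Suc j) choose 2) \<noteq> 0" by (simp add: binomial_eq_0_iff)
  then show ?thesis using Suc by simp
qed (simp add: binomial_eq_0)

definition fin_supp :: "weight \<Rightarrow> bool" where
  "fin_supp f \<longleftrightarrow> (\<exists>M. \<forall>h\<ge>M. f h = 0)"

text \<open>Summing over the support of the first argument gives a finite sum for
  \<open>fin_supp f\<close> and arbitrary \<open>g\<close>. As \<open>norm_weight 0 = 0\<close>,
  values at 0 are not seen.\<close>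

definition inner :: "weight \<Rightarrow> weight \<Rightarrow> rat" where
  "inner f g = (\<Sum>h | f h \<noteq> 0. norm_weight h * f h * g h)"

lemma inner_eq: "\<forall>h\<ge>M. f h = 0 \<Longrightarrow> inner f g = (\<Sum>h<M. norm_weight h * f h * g h)"
  unfolding inner_def by (rule sum.mono_neutral_left) (auto simp: not_le[symmetric])

lemma inner_commute:
  assumes "fin_supp f" "fin_supp g" shows "inner f g = inner g f"
proof -
  obtain M M' where "\<forall>h\<ge>M. f h = 0" "\<forall>h\<ge>M'. g h = 0" using assms by (auto simp: fin_supp_def)
  then have *: "\<forall>h\<ge>max M M'. f h = 0" "\<forall>h\<ge>max M M'. g h = 0" by auto
  show ?thesis unfolding *[THEN inner_eq] by (simp add: mult_ac)
qed

lemma inner_add: "inner f (\<lambda>h. g h + k h) = inner f g + inner f k"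
  by (simp add: inner_def distrib_left sum.distrib)

lemma inner_diff: "inner f (\<lambda>h. g h - k h) = inner f g - inner f k"
  by (simp add: inner_def right_diff_distrib sum_subtractf)

lemma inner_unit: "inner (unit (Suc 0)) g = g (Suc 0)"
  by (simp add: inner_def unit_def)

lemma fin_supp_unit: "fin_supp (unit j)"
  unfolding fin_supp_def unit_def by (intro exI[of _ "Suc j"]) auto

lemma fin_supp_up: "fin_supp f \<Longrightarrow> fin_supp (up f)"
  unfolding fin_supp_def up_def by (blast intro: le_SucI)

lemma fin_supp_down: "fin_supp f \<Longrightarrow> fin_supp (down f)"
proof -
  assume "fin_supp f"
  then obtain M where "\<forall>h\<ge>M. f h = 0" by (auto simp: fin_supp_def)
  then show ?thesis unfolding fin_supp_def down_def by (intro exI[of _ "Suc M"]) auto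
qed

lemma fin_supp_euler: "fin_supp f \<Longrightarrow> fin_supp (euler f)"
  unfolding fin_supp_def euler_def by auto

lemma step_eq: "step f = (\<lambda>h. up f h + down f h)"
  by (simp add: step_def up_def down_def fun_eq_iff)

lemma fin_supp_step: "fin_supp f \<Longrightarrow> fin_supp (step f)"
proof -
  assume "fin_supp f"
  then have "fin_supp (up f)" "fin_supp (down f)" by (simp_all add: fin_supp_up fin_supp_down)
  then obtain M M' where "\<forall>h\<ge>M. up f h = 0" "\<forall>h\<ge>M'. down f h = 0"
    unfolding fin_supp_def by blast
  then show ?thesis unfolding step_eq fin_supp_def by (intro exI[of _ "max M M'"]) auto
qed

lemma fin_supp_step_pow: "fin_supp f \<Longrightarrow> fin_supp ((step ^^ a) f)"
  by (induction a) (simp_all add: fin_supp_step)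

lemma inner_euler: assumes "fin_supp f" shows "inner f (euler g) = inner (euler f) g"
proof -
  obtain M where M: "\<forall>h\<ge>M. f h = 0" using assms by (auto simp: fin_supp_def)
  then have M': "\<forall>h\<ge>M. euler f h = 0" by (simp add: euler_def)
  show ?thesis unfolding inner_eq[OF M] inner_eq[OF M'] by (simp add: euler_def mult_ac)
qed

text \<open>An index shift by one; \<open>norm_weight_Suc\<close> absorbs the binomial
  factor.\<close>

lemma inner_down: assumes "fin_supp f" shows "inner f (down g) = inner (up f) g"
proof -
  obtain M where M: "\<forall>h\<ge>M. f h = 0" using assms by (auto simp: fin_supp_def)
  then have M': "\<forall>h\<ge>Suc M. f h = 0" and U: "\<forall>h\<ge>M. up f h = 0" by (simp_all add: up_def)
  have "inner f (down g) = (\<Sum>h<Suc M. norm_weight h * f h * down g h)" by (rule inner_eq[OF M'])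
  also have "\<dots> = (\<Sum>h<M. (norm_weight (Suc h) * of_nat (Suc h choose 2)) * f (Suc h) * g h)"
    by (subst sum.lessThan_Suc_shift) (simp add: down_def mult_ac)
  also have "\<dots> = inner (up f) g" unfolding norm_weight_Suc inner_eq[OF U] by (simp add: up_def)
  finally show ?thesis .
qed

lemma inner_up: assumes "fin_supp f" shows "inner f (up g) = inner (down f) g"
proof -
  obtain M where M: "\<forall>h\<ge>M. f h = 0" using assms by (auto simp: fin_supp_def)
  then have D: "\<forall>h\<ge>Suc M. down f h = 0" by (auto simp: down_def)
  have "inner (down f) g = (\<Sum>h<Suc M. norm_weight h * down f h * g h)"
    by (rule inner_eq[OF D])
  also have "\<dots> = (\<Sum>h<M. (norm_weight (Suc h) * of_nat (Suc h choose 2)) * f h * g (Suc h))"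
    by (subst sum.lessThan_Suc_shift) (simp add: down_def mult_ac)
  also have "\<dots> = inner f (up g)" unfolding norm_weight_Suc inner_eq[OF M] by (simp add: up_def)
  finally show ?thesis by simp
qed

lemma inner_step: "inner f (step g) = inner (step f) g" if "fin_supp f" "fin_supp g"
proof -
  have "inner f (step g) = inner f (up g) + inner f (down g)"
    by (simp add: step_eq inner_add)
  also have "\<dots> = inner (down f) g + inner (up f) g"
    using that by (simp add: inner_up inner_down)
  also have "\<dots> = inner g (down f) + inner g (up f)"
    using that by (simp add: inner_commute[of g] fin_supp_up fin_supp_down)
  also have "\<dots> = inner g (step f)"
    by (simp add: step_eq inner_add)
  finally show ?thesis using that by (simp add: inner_commute[of g] fin_supp_step)
qed

lemma inner_step_pow: "inner f ((step ^^ a) g) = inner ((step ^^ a) f) g"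
  if "fin_supp f" "fin_supp g"
  using that
proof (induction a arbitrary: f)
  case (Suc a)
  then show ?case
    using inner_step[of f "(step ^^ a) g"] Suc.IH[of "step f"]
    by (simp add: fin_supp_step fin_supp_step_pow funpow_swap1)
qed simp

section \<open>Self-adjointness of the middle operator\<close>

definition mid :: "nat \<Rightarrow> weight \<Rightarrow> weight" where
  "mid a f h = euler ((step ^^ a) (\<lambda>h. euler f h - f h)) h
     + euler (shift_sum a (euler f)) h + (step ^^ a) (euler f) h"

lemma mid_0: "mid 0 f = euler (euler f)"
  by (simp add: mid_def fun_eq_iff euler_def algebra_simps)

text \<open>The definition of \<open>mid\<close> is the form delivered by counting; this one
  exhibits the symmetry. After \<open>euler_shift_sum\<close>, A^(a+1) f is split at its innermost
  factor and A^(a+1) \<theta> f at its outermost one, which lowers the coefficients 2 to 1.\<close>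

lemma mid_Suc:
  "mid (Suc a) f = (\<lambda>h. euler ((step ^^ Suc a) (euler f)) h
      + euler ((step ^^ a) (down f)) h - euler ((step ^^ a) (up f)) h
      + up ((step ^^ a) (euler f)) h - down ((step ^^ a) (euler f)) h)"
proof
  fix h
  have "(step ^^ Suc a) f h = (step ^^ a) (up f) h + (step ^^ a) (down f) h" for h
    unfolding step_pow_Suc step_eq[of f] step_pow_add ..
  moreover have "(step ^^ Suc a) (euler f) h = up ((step ^^ a) (euler f)) h + down ((step ^^ a) (euler f)) h"
    by (simp add: step_eq)
  moreover have "mid (Suc a) f h = of_nat h * (step ^^ Suc a) (euler f) h - of_nat h * (step ^^ Suc a) f h
      + (2 * euler ((step ^^ a) (down f)) h - 2 * down ((step ^^ a) (euler f)) h) + (step ^^ Suc a) (euler f) h"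
    unfolding mid_def step_pow_diff euler_shift_sum
    by (simp only: euler_def[of "\<lambda>h. (step ^^ Suc a) (euler f) h - (step ^^ Suc a) f h"] right_diff_distrib)
  ultimately show "mid (Suc a) f h = euler ((step ^^ Suc a) (euler f)) h
      + euler ((step ^^ a) (down f)) h - euler ((step ^^ a) (up f)) h
      + up ((step ^^ a) (euler f)) h - down ((step ^^ a) (euler f)) h"
    by (simp only: euler_def[of "(step ^^ a) (down f)"] euler_def[of "(step ^^ a) (up f)"]
        euler_def[of "(step ^^ Suc a) (euler f)"] ring_distribs)
qed

lemma inner_euler_step_pow_euler:
  assumes "fin_supp f" "fin_supp g"
  shows "inner f (euler ((step ^^ a) (euler g))) = inner g (euler ((step ^^ a) (euler f)))"
proof -
  have "inner f (euler ((step ^^ a) (euler g))) = inner ((step ^^ a) (euler f)) (euler g)"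
    using assms by (simp add: inner_euler inner_step_pow fin_supp_euler)
  also have "\<dots> = inner (euler ((step ^^ a) (euler f))) g"
    using assms by (simp add: inner_euler fin_supp_euler fin_supp_step_pow)
  finally show ?thesis
    using assms by (simp add: inner_commute[of g] fin_supp_euler fin_supp_step_pow)
qed

text \<open>The term \<theta> A^a D is adjoint to U A^a \<theta>, and \<theta> A^a U to D A^a
  \<theta>; in \<open>mid_Suc\<close> the two members of each pair carry the same sign.\<close>

lemma inner_mid: "inner f (mid a g) = inner g (mid a f)" if "fin_supp f" "fin_supp g"
proof -
  note fs = fin_supp_step_pow fin_supp_euler fin_supp_up fin_supp_down
  have 1: "inner f (euler ((step ^^ a) (euler g))) = inner g (euler ((step ^^ a) (euler f)))" for a
    using that by (rule inner_euler_step_pow_euler)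
  have 2: "inner f (euler ((step ^^ a) (down g))) = inner g (up ((step ^^ a) (euler f)))"
    if "fin_supp f" "fin_supp g" for a f g
  proof -
    have "inner f (euler ((step ^^ a) (down g))) = inner ((step ^^ a) (euler f)) (down g)"
      using that by (simp add: inner_euler inner_step_pow fs)
    also have "\<dots> = inner (up ((step ^^ a) (euler f))) g" using that by (simp add: inner_down fs)
    finally show ?thesis using that by (simp add: inner_commute[of g] fs)
  qed
  have 3: "inner f (euler ((step ^^ a) (up g))) = inner g (down ((step ^^ a) (euler f)))"
    if "fin_supp f" "fin_supp g" for a f g
  proof -
    have "inner f (euler ((step ^^ a) (up g))) = inner ((step ^^ a) (euler f)) (up g)"
      using that by (simp add: inner_euler inner_step_pow fs)
    also have "\<dots> = inner (down ((step ^^ a) (euler f))) g" using that by (simp add: inner_up fs)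
    finally show ?thesis using that by (simp add: inner_commute[of g] fs)
  qed
  show ?thesis
  proof (cases a)
    case 0
    then show ?thesis using 1[of 0] by (simp add: mid_0)
  next
    case (Suc b)
    show ?thesis unfolding Suc mid_Suc inner_add inner_diff
      using 1[of "Suc b"] 2[of f g b] 2[of g f b] 3[of f g b] 3[of g f b] that by simp
  qed
qed

section \<open>Partial trees\<close>

text \<open>
  In \<open>forest N i E\<close> the labels above \<open>i\<close> have been read; \<open>ext N i E\<close> are the trees completing it.
\<close>

definition forest :: "nat \<Rightarrow> nat \<Rightarrow> (nat \<times> nat) set \<Rightarrow> bool" where
  "forest N i E \<longleftrightarrow>
     E \<subseteq> {i<..N} \<times> {i<..N} \<and> (\<forall>u v. (u, v) \<in> E \<longrightarrow> u < v) \<and>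
     (\<forall>u u' v. (u, v) \<in> E \<longrightarrow> (u', v) \<in> E \<longrightarrow> u = u') \<and>
     (\<forall>u. E `` {u} = {} \<or> card (E `` {u}) = 2)"

definition roots :: "nat \<Rightarrow> nat \<Rightarrow> (nat \<times> nat) set \<Rightarrow> nat set" where
  "roots N i E = {i<..N} - Range E"

text \<open>Connectivity is implicit: following parents lowers the label and can stop only at the
  single root 1.\<close>

definition trees :: "nat \<Rightarrow> (nat \<times> nat) set set" where
  "trees N = {T. forest N 0 T \<and> roots N 0 T = {1}}"

definition ext :: "nat \<Rightarrow> nat \<Rightarrow> (nat \<times> nat) set \<Rightarrow> (nat \<times> nat) set set" where
  "ext N i E = {T \<in> trees N. {e \<in> T. i < fst e} = E}"

definition pairs :: "nat set \<Rightarrow> nat set set" where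
  "pairs H = {S. S \<subseteq> H \<and> card S = 2}"

abbreviation join :: "nat \<Rightarrow> nat set \<Rightarrow> (nat \<times> nat) set \<Rightarrow> (nat \<times> nat) set" where
  "join c S E \<equiv> E \<union> {c} \<times> S"

lemma forestD:
  assumes "forest N i E"
  shows "(u, v) \<in> E \<Longrightarrow> i < u" "(u, v) \<in> E \<Longrightarrow> v \<le> N" "(u, v) \<in> E \<Longrightarrow> u < v"
    "(u, v) \<in> E \<Longrightarrow> (u', v) \<in> E \<Longrightarrow> u = u'" "E `` {u} = {} \<or> card (E `` {u}) = 2"
proof -
  have "E \<subseteq> {i<..N} \<times> {i<..N}" using assms by (simp add: forest_def)
  then show "(u, v) \<in> E \<Longrightarrow> i < u" "(u, v) \<in> E \<Longrightarrow> v \<le> N" by auto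
  show "(u, v) \<in> E \<Longrightarrow> u < v" using assms unfolding forest_def by meson
  show "(u, v) \<in> E \<Longrightarrow> (u', v) \<in> E \<Longrightarrow> u = u'" using assms unfolding forest_def by meson
  show "E `` {u} = {} \<or> card (E `` {u}) = 2" using assms unfolding forest_def by meson
qed

lemma finite_roots [simp]: "finite (roots N i E)"
  by (simp add: roots_def)

lemma roots_gt: "v \<in> roots N i E \<Longrightarrow> i < v"
  by (simp add: roots_def)

lemma finite_trees [simp]: "finite (trees N)"
proof (rule finite_subset)
  show "trees N \<subseteq> Pow ({0<..N} \<times> {0<..N})" by (auto simp: trees_def forest_def)
qed simp

lemma finite_ext [simp]: "finite (ext N i E)"
  by (simp add: ext_def)

lemma finite_pairs [simp]: "finite H \<Longrightarrow> finite (pairs H)"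
  by (simp add: pairs_def)

lemma card_pairs: "finite H \<Longrightarrow> card (pairs H) = card H choose 2"
  unfolding pairs_def by (rule n_subsets)

lemma pairs_mono: "H \<subseteq> H' \<Longrightarrow> pairs H \<subseteq> pairs H'"
  by (auto simp: pairs_def)

lemma forest_leaf: "forest N (Suc i) E \<Longrightarrow> forest N i E"
proof -
  have "{Suc i<..N} \<times> {Suc i<..N} \<subseteq> {i<..N} \<times> {i<..N}" by auto
  then show "forest N (Suc i) E \<Longrightarrow> forest N i E" unfolding forest_def by blast
qed

lemma roots_leaf:
  assumes "forest N (Suc i) E" "Suc i \<le> N"
  shows "roots N i E = insert (Suc i) (roots N (Suc i) E)"
proof -
  have "Suc i \<notin> Range E" using assms(1) by (auto simp: forest_def)
  then show ?thesis using assms(2) by (auto simp: roots_def)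
qed

lemma Image_above:
  assumes "forest N (Suc i) E" shows "E `` {Suc i} = {}"
  using forestD(1)[OF assms] by blast

lemma forest_join:
  assumes E: "forest N (Suc i) E" and N: "Suc i \<le> N" and S: "S \<in> pairs (roots N (Suc i) E)"
  shows "forest N i (join (Suc i) S E)"
proof -
  have S': "v \<in> S \<Longrightarrow> Suc i < v \<and> v \<le> N \<and> v \<notin> Range E" for v
    using S by (auto simp: pairs_def roots_def)
  have "join (Suc i) S E `` {u} = (if u = Suc i then S else E `` {u})" for u
    using Image_above[OF E] by auto
  then have deg: "join (Suc i) S E `` {u} = {} \<or> card (join (Suc i) S E `` {u}) = 2" for u
    using S forestD(5)[OF E, of u] by (simp add: pairs_def)
  have sub: "join (Suc i) S E \<subseteq> {i<..N} \<times> {i<..N}"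
  proof (rule Un_least)
    show "E \<subseteq> {i<..N} \<times> {i<..N}" using forest_leaf[OF E] by (simp add: forest_def)
    have "S \<subseteq> {i<..N}"
    proof
      fix v assume "v \<in> S"
      from S'[OF this] show "v \<in> {i<..N}" by simp
    qed
    then show "{Suc i} \<times> S \<subseteq> {i<..N} \<times> {i<..N}" using N by auto
  qed
  have incr: "u < v" if "(u, v) \<in> join (Suc i) S E" for u v
  proof (cases "(u, v) \<in> E")
    case False
    with that have "u = Suc i" "v \<in> S" by auto
    with S' show ?thesis by simp
  qed (rule forestD(3)[OF E])
  have uniq: "u = u'" if "(u, v) \<in> join (Suc i) S E" "(u', v) \<in> join (Suc i) S E" for u u' v
  proof (cases "v \<in> S")
    case True
    then have "(u, v) \<notin> E" "(u', v) \<notin> E" using S' by blast+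
    then show ?thesis using that by simp
  next
    case False
    then have "(u, v) \<in> E" "(u', v) \<in> E" using that by simp_all
    then show ?thesis by (rule forestD(4)[OF E])
  qed
  show ?thesis unfolding forest_def
    by (intro conjI allI impI sub deg) (erule incr, erule uniq)
qed

lemma roots_join:
  assumes "forest N (Suc i) E" "Suc i \<le> N" "S \<subseteq> roots N (Suc i) E"
  shows "roots N i (join (Suc i) S E) = insert (Suc i) (roots N (Suc i) E - S)"
proof -
  have "Suc i \<notin> Range E" using assms(1) by (auto simp: forest_def)
  moreover have "Suc i \<notin> S" using assms(3) by (auto simp: roots_def)
  ultimately show ?thesis using assms(2) by (auto simp: roots_def)
qed

lemma card_roots_leaf:
  assumes "forest N (Suc i) E" "Suc i \<le> N"
  shows "card (roots N i E) = Suc (card (roots N (Suc i) E))"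
proof -
  have "Suc i \<notin> roots N (Suc i) E" by (simp add: roots_def)
  then show ?thesis by (simp add: roots_leaf[OF assms])
qed

lemma card_roots_join:
  assumes "forest N (Suc i) E" "Suc i \<le> N" "S \<in> pairs (roots N (Suc i) E)"
  shows "card (roots N i (join (Suc i) S E)) = card (roots N (Suc i) E) - 1"
    and "2 \<le> card (roots N (Suc i) E)"
proof -
  let ?R = "roots N (Suc i) E"
  have S: "S \<subseteq> ?R" "card S = 2" using assms(3) by (simp_all add: pairs_def)
  then show 2: "2 \<le> card ?R" by (metis card_mono finite_roots)
  have "Suc i \<notin> ?R" by (simp add: roots_def)
  moreover have "card (?R - S) = card ?R - 2"
    using S by (simp add: card_Diff_subset finite_subset[OF S(1)])
  ultimately show "card (roots N i (join (Suc i) S E)) = card ?R - 1"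
    using 2 by (simp add: roots_join[OF assms(1,2) S(1)])
qed

section \<open>Completions of a partial tree\<close>

lemma ext_join:
  assumes "forest N (Suc i) E"
  shows "ext N i (join (Suc i) S E) = {T \<in> ext N (Suc i) E. T `` {Suc i} = S}"
proof -
  have "{e \<in> T. i < fst e} = join (Suc i) S E \<longleftrightarrow> {e \<in> T. Suc i < fst e} = E \<and> T `` {Suc i} = S" for T
  proof -
    have split: "{e \<in> T. i < fst e} = join (Suc i) (T `` {Suc i}) {e \<in> T. Suc i < fst e}"
      by auto (metis Suc_lessI)
    have cancel: "join (Suc i) S E = join (Suc i) S' E' \<longleftrightarrow> E = E' \<and> S = S'"
      if "\<And>u v. (u, v) \<in> E \<Longrightarrow> u \<noteq> Suc i" "\<And>u v. (u, v) \<in> E' \<Longrightarrow> u \<noteq> Suc i" for S S' E E'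
    proof
      assume eq: "join (Suc i) S E = join (Suc i) S' E'"
      have "(u, v) \<in> E \<longleftrightarrow> (u, v) \<in> E'" "v \<in> S \<longleftrightarrow> v \<in> S'" for u v
        using that eq by blast+
      then show "E = E' \<and> S = S'" by (auto simp: set_eq_iff)
    qed simp
    show ?thesis unfolding split
      by (subst cancel) (use forestD(1)[OF assms] in auto)
  qed
  then show ?thesis by (auto simp: ext_def)
qed

lemma ext_leaf:
  assumes "forest N (Suc i) E"
  shows "ext N i E = {T \<in> ext N (Suc i) E. T `` {Suc i} = {}}"
  using ext_join[OF assms, of "{}"] by simp

lemma ext_forest: "T \<in> ext N i E \<Longrightarrow> forest N 0 T"
  by (simp add: ext_def trees_def)

lemma ext_subset: "T \<in> ext N i E \<Longrightarrow> E \<subseteq> T"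
  by (auto simp: ext_def)

lemma ext_children:
  assumes "T \<in> ext N (Suc i) E"
  shows "T `` {Suc i} = {} \<or> T `` {Suc i} \<in> pairs (roots N (Suc i) E)"
proof -
  note T = forestD[OF ext_forest[OF assms]]
  have "v \<in> roots N (Suc i) E" if v: "(Suc i, v) \<in> T" for v
  proof -
    have "(u, v) \<notin> E" for u
    proof
      assume "(u, v) \<in> E"
      then have "(u, v) \<in> T" "Suc i < u" using assms by (auto simp: ext_def)
      with T(4)[OF v, of u] show False by simp
    qed
    then show ?thesis using T(2,3)[OF v] by (auto simp: roots_def)
  qed
  then show ?thesis using T(5)[of "Suc i"] by (auto simp: pairs_def)
qed

text \<open>Completions are classified by the children of the next label \<open>Suc i\<close>: none
  (the class of \<open>{}\<close>) or a pair of current roots.\<close>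

lemma count_split:
  assumes "forest N (Suc i) E"
  shows "card {T \<in> ext N (Suc i) E. P T} = card {T \<in> ext N i E. P T} +
    (\<Sum>S \<in> pairs (roots N (Suc i) E). card {T \<in> ext N i (join (Suc i) S E). P T})"
proof -
  let ?R = "pairs (roots N (Suc i) E)"
  let ?X = "{T \<in> ext N (Suc i) E. P T}"
  let ?B = "\<lambda>S. {T \<in> ?X. T `` {Suc i} = S}"
  have ne: "{} \<notin> ?R" by (auto simp: pairs_def)
  have "card ?X = card (\<Union>S \<in> insert {} ?R. ?B S)"
    using ext_children[of _ N i E] by (intro arg_cong[where f = card]) blast
  also have "\<dots> = (\<Sum>S \<in> insert {} ?R. card (?B S))"
    by (rule card_UN_disjoint) auto
  also have "\<dots> = card (?B {}) + (\<Sum>S \<in> ?R. card (?B S))"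
    using ne by simp
  also have "?B {} = {T \<in> ext N i E. P T}"
    by (auto simp: ext_leaf[OF assms])
  also have "(\<Sum>S \<in> ?R. card (?B S)) = (\<Sum>S \<in> ?R. card {T \<in> ext N i (join (Suc i) S E). P T})"
    unfolding ext_join[OF assms] by (intro sum.cong arg_cong[where f = card]) auto
  finally show ?thesis .
qed

abbreviation count :: "'b set \<Rightarrow> rat" where
  "count X \<equiv> of_nat (card X)"

text \<open>The roots in \<open>H\<close> are free, the others reserved. A leaf raises the number of
  free roots by one and joining two free roots lowers it by one, which is the action of
  \<open>step\<close>; joins touching a reserved root stay in the explicit sum.\<close>

lemma count_step:
  assumes E: "forest N (Suc i) E" and H: "H \<subseteq> roots N (Suc i) E" "card H = h"
    and leaf: "count {T \<in> ext N i E. P T} = f (Suc h)"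
    and pair: "\<And>S. S \<in> pairs H \<Longrightarrow> count {T \<in> ext N i (join (Suc i) S E). P T} = f (h - 1)"
  shows "count {T \<in> ext N (Suc i) E. P T} = step f h +
    (\<Sum>S \<in> pairs (roots N (Suc i) E) - pairs H. count {T \<in> ext N i (join (Suc i) S E). P T})"
proof -
  let ?g = "\<lambda>S. count {T \<in> ext N i (join (Suc i) S E). P T}"
  have fin: "finite H" by (rule finite_subset[OF H(1)]) simp
  have "count {T \<in> ext N (Suc i) E. P T} = f (Suc h) + (\<Sum>S \<in> pairs (roots N (Suc i) E). ?g S)"
    unfolding count_split[OF E] of_nat_add of_nat_sum leaf ..
  also have "(\<Sum>S \<in> pairs (roots N (Suc i) E). ?g S)
      = (\<Sum>S \<in> pairs (roots N (Suc i) E) - pairs H. ?g S) + (\<Sum>S \<in> pairs H. ?g S)"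
    by (rule sum.subset_diff[OF pairs_mono[OF H(1)]]) simp
  also have "(\<Sum>S \<in> pairs H. ?g S) = of_nat (h choose 2) * f (h - 1)"
    using fin H(2) by (simp add: pair card_pairs)
  finally show ?thesis by (simp add: step_def)
qed

section \<open>The minimal chain\<close>

definition min_child :: "(nat \<times> nat) set \<Rightarrow> (nat \<times> nat) set" where
  "min_child T = {(u, v). T `` {u} \<noteq> {} \<and> v = Min (T `` {u})}"

definition chain :: "(nat \<times> nat) set \<Rightarrow> nat set" where
  "chain T = (min_child T)\<^sup>* `` {1}"

text \<open>The condition carried through the downward reading: two current roots are promised a
  common parent on the chain, a vertex that may still be unread.\<close>

definition chain_pair :: "(nat \<times> nat) set \<Rightarrow> nat \<Rightarrow> nat \<Rightarrow> bool" where
  "chain_pair T r s \<longleftrightarrow> (\<exists>c \<in> chain T. T `` {c} = {r, s})"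

lemma one_in_chain: "1 \<in> chain T"
  by (simp add: chain_def)

text \<open>
  The sibling of a chain vertex \<open>c\<close> has a larger label, so it is already present when \<open>c\<close> is read and can be
  reserved at that moment.
\<close>

lemma chain_iff_chain_pair:
  assumes T: "T \<in> ext N i E" and c: "Suc i \<in> roots N i E" and i: "i > 0"
  shows "Suc i \<in> chain T \<longleftrightarrow> (\<exists>s \<in> roots N i E - {Suc i}. chain_pair T (Suc i) s)"
proof
  note F = forestD[OF ext_forest[OF T]]
  assume "Suc i \<in> chain T"
  then have "(1, Suc i) \<in> (min_child T)\<^sup>*" by (simp add: chain_def)
  then obtain d where d: "d \<in> chain T" "(d, Suc i) \<in> min_child T"
  proof (cases rule: rtranclE)
    case (step d)
    then show ?thesis using that by (simp add: chain_def)
  qed (use i in simp)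
  then have ne: "T `` {d} \<noteq> {}" and min: "Suc i = Min (T `` {d})"
    unfolding min_child_def by blast+
  have "card (T `` {d}) = 2" using F(5)[of d] ne by simp
  moreover from this have fin: "finite (T `` {d})" by (simp add: card_ge_0_finite)
  moreover have mem: "Suc i \<in> T `` {d}" unfolding min by (rule Min_in[OF fin ne])
  ultimately have "card (T `` {d} - {Suc i}) = 1" by simp
  then obtain s where "T `` {d} - {Suc i} = {s}" by (rule card_1_singletonE)
  with mem have s: "T `` {d} = {Suc i, s}" "s \<noteq> Suc i" by blast+
  then have "(d, s) \<in> T" by blast
  have "Min (T `` {d}) \<le> s" using Min_le[OF fin] \<open>(d, s) \<in> T\<close> by blast
  then have "Suc i < s" unfolding min[symmetric] using s(2) by simp
  have "d < Suc i" using mem F(3)[of d "Suc i"] by simp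
  have "(u, s) \<notin> E" for u
  proof
    assume u: "(u, s) \<in> E"
    then have "(u, s) \<in> T" using ext_subset[OF T] by blast
    then have "u = d" using \<open>(d, s) \<in> T\<close> by (rule F(4))
    moreover have "i < u" using u T by (auto simp: ext_def)
    ultimately show False using \<open>d < Suc i\<close> by simp
  qed
  then have "s \<in> roots N i E - {Suc i}"
    using \<open>Suc i < s\<close> F(2)[OF \<open>(d, s) \<in> T\<close>] by (auto simp: roots_def)
  moreover have "chain_pair T (Suc i) s"
    using d(1) s(1) unfolding chain_pair_def by blast
  ultimately show "\<exists>s \<in> roots N i E - {Suc i}. chain_pair T (Suc i) s" by blast
next
  assume "\<exists>s \<in> roots N i E - {Suc i}. chain_pair T (Suc i) s"
  then obtain s d where "s \<in> roots N i E" "s \<noteq> Suc i" and d: "d \<in> chain T" "T `` {d} = {Suc i, s}"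
    unfolding chain_pair_def by blast
  then have "Suc i < s" using roots_gt[of s N i E] by simp
  then have "Min (T `` {d}) = Suc i" unfolding d(2) by simp
  then have "(d, Suc i) \<in> min_child T" unfolding min_child_def using d(2) by simp
  moreover have "(1, d) \<in> (min_child T)\<^sup>*" using d(1) by (simp add: chain_def)
  ultimately show "Suc i \<in> chain T" unfolding chain_def by (simp add: rtrancl_into_rtrancl)
qed

text \<open>A tree determines the sibling, so the classes are disjoint. The condition
  \<open>i > 0\<close> excludes the vertex 1, which is on the chain without a sibling.\<close>

lemma count_chain:
  assumes c: "Suc i \<in> roots N i E" and i: "i > 0"
  shows "count {T \<in> ext N i E. Suc i \<in> chain T \<and> P T} =
    (\<Sum>s \<in> roots N i E - {Suc i}. count {T \<in> ext N i E. chain_pair T (Suc i) s \<and> P T})"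
proof -
  let ?B = "\<lambda>s. {T \<in> ext N i E. chain_pair T (Suc i) s \<and> P T}"
  have disj: "?B s \<inter> ?B s' = {}" if "s \<noteq> s'" for s s'
  proof (rule ccontr)
    assume "?B s \<inter> ?B s' \<noteq> {}"
    then obtain T where T: "T \<in> ext N i E" "chain_pair T (Suc i) s" "chain_pair T (Suc i) s'"
      by blast
    then obtain d d' where d: "T `` {d} = {Suc i, s}" "T `` {d'} = {Suc i, s'}"
      unfolding chain_pair_def by blast
    then have "(d, Suc i) \<in> T" "(d', Suc i) \<in> T" by blast+
    then have "d = d'" by (rule forestD(4)[OF ext_forest[OF T(1)]])
    with d have "{Suc i, s} = {Suc i, s'}" by simp
    with that show False by (simp add: doubleton_eq_iff)
  qed
  have "{T \<in> ext N i E. Suc i \<in> chain T \<and> P T} = (\<Union>s \<in> roots N i E - {Suc i}. ?B s)"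
    by (auto simp: chain_iff_chain_pair[OF _ c i])
  then have "card {T \<in> ext N i E. Suc i \<in> chain T \<and> P T} = card (\<Union>s \<in> roots N i E - {Suc i}. ?B s)"
    by (rule arg_cong)
  also have "\<dots> = (\<Sum>s \<in> roots N i E - {Suc i}. card (?B s))"
  proof (rule card_UN_disjoint)
    show "\<forall>s \<in> roots N i E - {Suc i}. \<forall>s' \<in> roots N i E - {Suc i}. s \<noteq> s' \<longrightarrow> ?B s \<inter> ?B s' = {}"
      by (intro ballI impI disj)
  qed simp_all
  finally show ?thesis by (simp only: of_nat_sum)
qed

text \<open>Parents are unique, so a shared child identifies \<open>Suc i\<close> with the promised
  parent.\<close>

lemma chain_pair_join:
  assumes "T \<in> ext N i (join (Suc i) S E)" "forest N (Suc i) E" "chain_pair T r s" "S \<inter> {r, s} \<noteq> {}"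
  shows "S = {r, s}" "Suc i \<in> chain T"
proof -
  from assms(3) obtain d where d: "d \<in> chain T" "T `` {d} = {r, s}"
    unfolding chain_pair_def by blast
  have S: "T `` {Suc i} = S" using assms(1) unfolding ext_join[OF assms(2)] by simp
  obtain x where "(Suc i, x) \<in> T" "(d, x) \<in> T" using assms(4) d(2) S by blast
  then have "Suc i = d" by (rule forestD(4)[OF ext_forest[OF assms(1)]])
  with d S show "S = {r, s}" "Suc i \<in> chain T" by simp_all
qed

lemma chain_pair_join_iff:
  assumes "T \<in> ext N i (join (Suc i) {r, s} E)" "forest N (Suc i) E"
  shows "chain_pair T r s \<longleftrightarrow> Suc i \<in> chain T"
proof
  assume "Suc i \<in> chain T"
  moreover have "T `` {Suc i} = {r, s}" using assms(1) unfolding ext_join[OF assms(2)] by simp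
  ultimately show "chain_pair T r s" unfolding chain_pair_def by blast
next
  assume "chain_pair T r s"
  from chain_pair_join(2)[OF assms this] show "Suc i \<in> chain T" by simp
qed

text \<open>With no label left, \<open>E\<close> is its own only possible completion, and it is a
  tree exactly when one root remains.\<close>

lemma ext_0:
  assumes "forest N 0 E" "1 \<le> N"
  shows "count (ext N 0 E) = unit 1 (card (roots N 0 E))"
proof -
  have "(u, 1) \<notin> E" for u
    using forestD(1)[OF assms(1), of u 1] forestD(3)[OF assms(1), of u 1] by auto
  then have 1: "1 \<in> roots N 0 E" using assms(2) by (auto simp: roots_def)
  have "{e \<in> T. 0 < fst e} = T" if "T \<in> trees N" for T
  proof -
    have "T \<subseteq> {0<..N} \<times> {0<..N}" using that by (simp add: trees_def forest_def)
    then show ?thesis by auto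
  qed
  then have *: "ext N 0 E = {T \<in> trees N. T = E}" by (auto simp: ext_def)
  show ?thesis
  proof (cases "roots N 0 E = {1}")
    case True
    then have "ext N 0 E = {E}" using assms * by (auto simp: trees_def)
    then show ?thesis by (simp add: True unit_def)
  next
    case False
    then have "ext N 0 E = {}" using * by (auto simp: trees_def)
    moreover have "card (roots N 0 E) \<noteq> 1" using False 1 by (auto simp: card_1_singleton_iff)
    ultimately show ?thesis by (simp add: unit_def)
  qed
qed

section \<open>Counting completions\<close>

text \<open>The value when \<open>Suc i\<close> is a root required to be on the chain and
  \<open>h\<close> counts the other roots: \<open>h\<close> choices of a sibling, each contributing
  \<open>pair_val i (h - 1)\<close>. For \<open>i = 0\<close> no other root may be left.\<close>

definition branch :: "nat \<Rightarrow> weight" where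
  "branch i = (if i = 0 then unit 0 else euler ((step ^^ (i - 1)) (unit 1)))"

text \<open>The value for a reserved pair beside \<open>h\<close> free roots. The pair acts as one
  root, hence \<open>Suc h\<close>; the final label 1 joins the last pair, hence only
  \<open>i - 1\<close> steps.\<close>

definition pair_val :: "nat \<Rightarrow> weight" where
  "pair_val i h = (if i = 0 then 0 else (step ^^ (i - 1)) (unit 1) (Suc h))"

lemma branch_eq: "i > 0 \<Longrightarrow> branch i h = of_nat h * pair_val i (h - 1)"
  by (cases h) (simp_all add: branch_def pair_val_def euler_def)

lemma choose_two_Suc: "(of_nat (Suc h choose 2) :: rat) = of_nat (h choose 2) + of_nat h"
  by (simp add: of_nat_choose_two field_simps)

text \<open>Joining the pair creates a chain vertex that picks one of \<open>h\<close> siblings. The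
  resulting \<open>h\<close> supplements \<open>h choose 2\<close> to \<open>Suc h choose 2\<close>,
  as if the pair had been a single root joined to a free one.\<close>

lemma pair_val_Suc: "pair_val (Suc i) h = step (pair_val i) h + branch i h"
proof (cases i)
  case 0
  then show ?thesis by (simp add: pair_val_def step_def branch_def unit_def)
next
  case (Suc j)
  show ?thesis unfolding Suc pair_val_def branch_def
    by (cases h) (simp_all add: step_def euler_def choose_two_Suc algebra_simps)
qed

lemma sum_eq_single:
  "finite A \<Longrightarrow> a \<in> A \<Longrightarrow> (\<And>x. x \<in> A \<Longrightarrow> x \<noteq> a \<Longrightarrow> g x = 0) \<Longrightarrow> sum g A = g a"
  for g :: "'b \<Rightarrow> 'c :: comm_monoid_add"
  by (subst sum.remove[of A a]) (simp_all add: sum.neutral)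

lemma empty_countI: "(\<And>T. T \<in> X \<Longrightarrow> \<not> P T) \<Longrightarrow> count {T \<in> X. P T} = 0"
  by (metis (mono_tags, lifting) Collect_empty_eq card.empty of_nat_0)

lemma notin_pairs_Diff: "S \<in> pairs R - pairs (R - A) \<Longrightarrow> S \<inter> A \<noteq> {}"
  by (auto simp: pairs_def)

lemma roots_le: "v \<in> roots N i E \<Longrightarrow> i < N"
  by (simp add: roots_def)

text \<open>The common induction step: \<open>A\<close> is the reserved set and \<open>h\<close>
  counts the remaining roots. Each application only has to treat the joins meeting
  \<open>A\<close>.\<close>

lemma count_step_reserved:
  assumes E: "forest N (Suc i) E" and N: "Suc i \<le> N" and A: "A \<subseteq> roots N (Suc i) E"
    and h: "card (roots N (Suc i) E) = h + card A"
    and IH: "\<And>E' h'. forest N i E' \<Longrightarrow> A \<subseteq> roots N i E' \<Longrightarrow> card (roots N i E') = h' + card A \<Longrightarrow>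
      count {T \<in> ext N i E'. P T} = f h'"
  shows "count {T \<in> ext N (Suc i) E. P T} = step f h +
    (\<Sum>S \<in> pairs (roots N (Suc i) E) - pairs (roots N (Suc i) E - A).
       count {T \<in> ext N i (join (Suc i) S E). P T})"
proof -
  let ?R = "roots N (Suc i) E"
  let ?H = "?R - A"
  have H: "card ?H = h" using h A finite_subset[OF A] by (simp add: card_Diff_subset)
  have leaf: "count {T \<in> ext N i E. P T} = f (Suc h)"
  proof (rule IH[OF forest_leaf[OF E]])
    show "A \<subseteq> roots N i E" using A by (auto simp: roots_leaf[OF E N])
    show "card (roots N i E) = Suc h + card A" using h by (simp add: card_roots_leaf[OF E N])
  qed
  have pair: "count {T \<in> ext N i (join (Suc i) S E). P T} = f (h - 1)"
    if S: "S \<in> pairs ?H" for S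
  proof -
    have S': "S \<in> pairs ?R" using S pairs_mono[of ?H ?R] by blast
    have sub: "S \<subseteq> ?R" and disj: "S \<inter> A = {}" using S by (auto simp: pairs_def)
    have "2 \<le> h" using S H card_mono[of ?H S] by (auto simp: pairs_def)
    show ?thesis
    proof (rule IH[OF forest_join[OF E N S']])
      show "card (roots N i (join (Suc i) S E)) = h - 1 + card A"
        using card_roots_join(1)[OF E N S'] h \<open>2 \<le> h\<close> by simp
      show "A \<subseteq> roots N i (join (Suc i) S E)"
        using A disj by (auto simp: roots_join[OF E N sub])
    qed
  qed
  show ?thesis by (rule count_step[OF E _ H leaf pair]) simp
qed

text \<open>The value for reserved pairs is a hypothesis, so that this can be applied inside the
  induction that establishes it.\<close>

lemma count_branch:
  assumes E: "forest N i E" and c: "Suc i \<in> roots N i E" and h: "card (roots N i E) = Suc h"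
    and pair: "\<And>s. s \<in> roots N i E \<Longrightarrow> s \<noteq> Suc i \<Longrightarrow>
      count {T \<in> ext N i E. chain_pair T (Suc i) s} = pair_val i (h - 1)"
  shows "count {T \<in> ext N i E. Suc i \<in> chain T} = branch i h"
proof (cases "i = 0")
  case True
  then have "{T \<in> ext N i E. Suc i \<in> chain T} = ext N 0 E"
    using one_in_chain by simp
  then show ?thesis using ext_0[of N E] E h roots_le[OF c] True by (simp add: branch_def unit_def)
next
  case False
  have "count {T \<in> ext N i E. Suc i \<in> chain T} = 
      (\<Sum>s \<in> roots N i E - {Suc i}. count {T \<in> ext N i E. chain_pair T (Suc i) s})"
    using count_chain[OF c, of "\<lambda>_. True"] False by simp
  also have "\<dots> = (\<Sum>s \<in> roots N i E - {Suc i}. pair_val i (h - 1))"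
    using pair by (intro sum.cong) auto
  also have "\<dots> = of_nat h * pair_val i (h - 1)"
    using c h by simp
  finally show ?thesis using False by (simp add: branch_eq)
qed

lemma count_chain_pair:
  assumes "forest N i E" "r \<in> roots N i E" "s \<in> roots N i E" "r \<noteq> s"
    and "card (roots N i E) = h + 2"
  shows "count {T \<in> ext N i E. chain_pair T r s} = pair_val i h"
  using assms
proof (induction i arbitrary: E r s h)
  case 0
  have "count (ext N 0 E) = 0"
    using ext_0[OF 0(1)] roots_le[OF 0(2)] 0(5) by (simp add: unit_def)
  then have "ext N 0 E = {}" by simp
  then show ?case by (simp add: pair_val_def)
next
  case (Suc i)
  note E = Suc.prems(1)
  let ?R = "roots N (Suc i) E"
  let ?H = "?R - {r, s}"
  have N: "Suc i \<le> N" using roots_le[OF Suc.prems(2)] by simp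
  have rs: "{r, s} \<in> pairs ?R" using Suc.prems by (simp add: pairs_def)
  have sub: "{r, s} \<subseteq> ?R" using Suc.prems by simp
  have "count {T \<in> ext N (Suc i) E. chain_pair T r s} = step (pair_val i) h +
    (\<Sum>S \<in> pairs ?R - pairs ?H. count {T \<in> ext N i (join (Suc i) S E). chain_pair T r s})"
    using Suc.prems by (intro count_step_reserved[OF E N sub] Suc.IH) simp_all
  \<comment> \<open>By \<open>chain_pair_join\<close>, a join touching the pair must be the pair
    itself.\<close>
  also have "(\<Sum>S \<in> pairs ?R - pairs ?H. count {T \<in> ext N i (join (Suc i) S E). chain_pair T r s})
      = count {T \<in> ext N i (join (Suc i) {r, s} E). chain_pair T r s}"
  proof (rule sum_eq_single)
    show "{r, s} \<in> pairs ?R - pairs ?H" using rs by (simp add: pairs_def)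
    fix S assume S: "S \<in> pairs ?R - pairs ?H" "S \<noteq> {r, s}"
    show "count {T \<in> ext N i (join (Suc i) S E). chain_pair T r s} = 0"
      by (rule empty_countI) (use chain_pair_join(1)[OF _ E _ notin_pairs_Diff[OF S(1)]] S(2) in metis)
  qed simp
  also have "{T \<in> ext N i (join (Suc i) {r, s} E). chain_pair T r s}
      = {T \<in> ext N i (join (Suc i) {r, s} E). Suc i \<in> chain T}"
    using chain_pair_join_iff[OF _ E] by (intro Collect_cong conj_cong refl)
  also have "count \<dots> = branch i h"
  proof (rule count_branch[OF forest_join[OF E N rs]])
    show card: "card (roots N i (join (Suc i) {r, s} E)) = Suc h"
      using card_roots_join(1)[OF E N rs] Suc.prems(5) by simp
    show c: "Suc i \<in> roots N i (join (Suc i) {r, s} E)"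
      unfolding roots_join[OF E N sub] by simp
    fix s' assume s': "s' \<in> roots N i (join (Suc i) {r, s} E)" "s' \<noteq> Suc i"
    have "card {Suc i, s'} \<le> card (roots N i (join (Suc i) {r, s} E))"
      using c s' by (intro card_mono) simp_all
    then have "h \<ge> 1" using s'(2) card by simp
    then show "count {T \<in> ext N i (join (Suc i) {r, s} E). chain_pair T (Suc i) s'} = pair_val i (h - 1)"
      using card s' c by (intro Suc.IH[OF forest_join[OF E N rs]]) auto
  qed
  finally show ?case by (simp add: pair_val_Suc)
qed

lemma count_chain_top:
  assumes E: "forest N i E" and c: "Suc i \<in> roots N i E" and h: "card (roots N i E) = Suc h"
  shows "count {T \<in> ext N i E. Suc i \<in> chain T} = branch i h"
proof (rule count_branch[OF assms])
  fix s assume s: "s \<in> roots N i E" "s \<noteq> Suc i"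
  have "card {Suc i, s} \<le> card (roots N i E)" using c s by (intro card_mono) simp_all
  then have "h \<ge> 1" using s(2) h by simp
  then show "count {T \<in> ext N i E. chain_pair T (Suc i) s} = pair_val i (h - 1)"
    using c s h by (intro count_chain_pair[OF E]) auto
qed

section \<open>Prescribing the parent of \<open>N\<close>\<close>

lemma parent_conflict:
  assumes "T \<in> ext N i (join (Suc i) S E)" "N \<in> S" "(k, N) \<in> T"
  shows "k = Suc i"
proof -
  have "(Suc i, N) \<in> T" using ext_subset[OF assms(1)] assms(2) by blast
  with assms(3) show ?thesis by (rule forestD(4)[OF ext_forest[OF assms(1)]])
qed

lemma count_parent_split:
  assumes E: "forest N (Suc i) E" and N: "N \<in> roots N (Suc i) E"
  shows "count {T \<in> ext N (Suc i) E. P T \<and> (Suc i, N) \<in> T} =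
    (\<Sum>x \<in> roots N (Suc i) E - {N}. count {T \<in> ext N i (join (Suc i) {x, N} E). P T})"
proof -
  let ?R = "roots N (Suc i) E"
  let ?A = "(\<lambda>x. {x, N}) ` (?R - {N})"
  let ?g = "\<lambda>S. count {T \<in> ext N i (join (Suc i) S E). P T \<and> (Suc i, N) \<in> T}"
  have "count {T \<in> ext N i E. P T \<and> (Suc i, N) \<in> T} = 0"
    unfolding ext_leaf[OF E] by (rule empty_countI) blast
  then have "count {T \<in> ext N (Suc i) E. P T \<and> (Suc i, N) \<in> T} = (\<Sum>S \<in> pairs ?R. ?g S)"
    unfolding count_split[OF E] of_nat_add of_nat_sum by simp
  also have "\<dots> = (\<Sum>S \<in> ?A. ?g S)"
  proof (rule sum.mono_neutral_right)
    show "?A \<subseteq> pairs ?R" using N by (auto simp: pairs_def)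
    show "\<forall>S \<in> pairs ?R - ?A. ?g S = 0"
    proof
      fix S assume S: "S \<in> pairs ?R - ?A"
      have "N \<notin> S"
      proof
        assume "N \<in> S"
        with S have "card (S - {N}) = 1" by (simp add: pairs_def)
        then obtain x where "S - {N} = {x}" by (rule card_1_singletonE)
        with \<open>N \<in> S\<close> have x: "S = {x, N}" "x \<noteq> N" by blast+
        with S have "x \<in> ?R - {N}" by (simp add: pairs_def)
        with x S show False by blast
      qed
      then show "?g S = 0" unfolding ext_join[OF E] by (intro empty_countI) blast
    qed
  qed simp
  also have "\<dots> = (\<Sum>x \<in> ?R - {N}. ?g {x, N})"
  proof (subst sum.reindex)
    show "inj_on (\<lambda>x. {x, N}) (?R - {N})" by (auto simp: inj_on_def doubleton_eq_iff)
  qed simp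
  also have "\<dots> = (\<Sum>x \<in> ?R - {N}. count {T \<in> ext N i (join (Suc i) {x, N} E). P T})"
    unfolding ext_join[OF E] by (intro sum.cong refl arg_cong[where f = "\<lambda>X. count X"]) blast
  finally show ?thesis .
qed


text \<open>A pair of a root and \<open>N\<close> stays frozen until its parent \<open>k\<close> is
  read; then \<open>k\<close> takes its place as a root on the chain, with value
  \<open>branch (k - 1)\<close>.\<close>

definition max_pair_val :: "nat \<Rightarrow> nat \<Rightarrow> weight" where
  "max_pair_val k i = (step ^^ (i - k)) (branch (k - 1))"

lemma count_chain_pair_max:
  assumes "forest N i E" "r \<in> roots N i E" "N \<in> roots N i E" "r \<noteq> N"
    and "card (roots N i E) = h + 2" and "1 \<le> k" "k \<le> i"
  shows "count {T \<in> ext N i E. chain_pair T r N \<and> (k, N) \<in> T} = max_pair_val k i h"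
  using assms
proof (induction i arbitrary: E h)
  case (Suc i)
  note E = Suc.prems(1)
  let ?R = "roots N (Suc i) E"
  have N: "Suc i \<le> N" using roots_le[OF Suc.prems(2)] by simp
  have rs: "{r, N} \<in> pairs ?R" and sub: "{r, N} \<subseteq> ?R" using Suc.prems by (simp_all add: pairs_def)
  show ?case
  proof (cases "k = Suc i")
    case True
    have "chain_pair T r N \<and> (k, N) \<in> T \<longleftrightarrow> T `` {Suc i} = {r, N} \<and> Suc i \<in> chain T"
      if T: "T \<in> ext N (Suc i) E" for T
    proof
      assume *: "chain_pair T r N \<and> (k, N) \<in> T"
      then obtain d where d: "d \<in> chain T" "T `` {d} = {r, N}" unfolding chain_pair_def by blast
      then have "(d, N) \<in> T" by blast
      moreover have "(Suc i, N) \<in> T" using * True by simp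
      ultimately have "d = Suc i" by (rule forestD(4)[OF ext_forest[OF T]])
      with d show "T `` {Suc i} = {r, N} \<and> Suc i \<in> chain T" by simp
    next
      assume *: "T `` {Suc i} = {r, N} \<and> Suc i \<in> chain T"
      then have "(Suc i, N) \<in> T" by blast
      with * True show "chain_pair T r N \<and> (k, N) \<in> T" unfolding chain_pair_def by blast
    qed
    then have "{T \<in> ext N (Suc i) E. chain_pair T r N \<and> (k, N) \<in> T}
        = {T \<in> ext N i (join (Suc i) {r, N} E). Suc i \<in> chain T}"
      unfolding ext_join[OF E] by auto
    moreover have "count {T \<in> ext N i (join (Suc i) {r, N} E). Suc i \<in> chain T} = branch i h"
    proof (rule count_chain_top[OF forest_join[OF E N rs]])
      show "card (roots N i (join (Suc i) {r, N} E)) = Suc h"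
        using card_roots_join(1)[OF E N rs] Suc.prems(5) by simp
      show "Suc i \<in> roots N i (join (Suc i) {r, N} E)"
        unfolding roots_join[OF E N sub] by simp
    qed
    ultimately show ?thesis using True by (simp add: max_pair_val_def)
  next
    case False
    then have k: "k \<le> i" using Suc.prems by simp
    have "count {T \<in> ext N (Suc i) E. chain_pair T r N \<and> (k, N) \<in> T} = step (max_pair_val k i) h +
      (\<Sum>S \<in> pairs ?R - pairs (?R - {r, N}).
        count {T \<in> ext N i (join (Suc i) S E). chain_pair T r N \<and> (k, N) \<in> T})"
      using Suc.prems k by (intro count_step_reserved[OF E N sub] Suc.IH) simp_all
    \<comment> \<open>A join touching the pair would be the pair, making \<open>Suc i\<close> the
      parent of \<open>N\<close> instead of \<open>k\<close>.\<close>
    also have "(\<Sum>S \<in> pairs ?R - pairs (?R - {r, N}).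
        count {T \<in> ext N i (join (Suc i) S E). chain_pair T r N \<and> (k, N) \<in> T}) = 0"
    proof (rule sum.neutral, rule ballI, rule empty_countI, rule notI)
      fix S T assume S: "S \<in> pairs ?R - pairs (?R - {r, N})"
        and T: "T \<in> ext N i (join (Suc i) S E)" "chain_pair T r N \<and> (k, N) \<in> T"
      have "S = {r, N}" using T(2) chain_pair_join(1)[OF T(1) E _ notin_pairs_Diff[OF S]] by simp
      then show False using parent_conflict[OF T(1), of k] T(2) False by simp
    qed
    finally show ?thesis using k by (simp add: max_pair_val_def Suc_diff_le)
  qed
qed simp

text \<open>
  The argument of \<open>open_val\<close> is one more than the number of free roots: counting the reserved pair as one
  further root turns the extra join of that pair into an ordinary \<open>step\<close>.
\<close>

definition open_start :: "nat \<Rightarrow> weight" where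
  "open_start k h = (of_nat h - 1) * (if k = 1 then 0 else (step ^^ (k - 2)) (unit 1) h)"

definition open_val :: "nat \<Rightarrow> nat \<Rightarrow> weight" where
  "open_val k a h = (step ^^ a) (open_start k) h + shift_sum a (branch (k - 1)) h"

text \<open>The reserved pair is left alone, or it is joined and the new chain vertex reserves a
  free root as its sibling, or it is joined and \<open>N\<close> becomes that sibling. In the last
  case \<open>shift\<close> compensates the offset of the argument.\<close>

lemma open_val_Suc:
  "open_val k (Suc a) (Suc h) = step (\<lambda>h. open_val k a (Suc h)) h
     + of_nat h * open_val k a (Suc (h - 1)) + (step ^^ a) (branch (k - 1)) h"
proof -
  have "open_val k (Suc a) (Suc h) = step (open_val k a) (Suc h) + (step ^^ a) (branch (k - 1)) h"
    unfolding open_val_def[abs_def] by (simp add: step_add shift_def)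
  also have "step (open_val k a) (Suc h) = step (\<lambda>h. open_val k a (Suc h)) h
     + of_nat h * open_val k a (Suc (h - 1))"
    by (cases h) (simp_all add: step_def choose_two_Suc algebra_simps)
  finally show ?thesis .
qed

text \<open>The pair and \<open>N\<close> are reserved separately; whether \<open>k\<close> will be
  on the chain is still open.\<close>

lemma count_chain_pair_open:
  assumes "forest N i E" "{r, s, N} \<subseteq> roots N i E" "r \<noteq> s" "r \<noteq> N" "s \<noteq> N"
    and "card (roots N i E) = h + 3" and "1 \<le> k" "k \<le> i"
  shows "count {T \<in> ext N i E. chain_pair T r s \<and> (k, N) \<in> T} = open_val k (i - k) (Suc h)"
  using assms
proof (induction i arbitrary: E r s h)
  case (Suc i)
  note E = Suc.prems(1)
  let ?R = "roots N (Suc i) E"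
  have N: "Suc i \<le> N" using roots_le[of r N "Suc i" E] Suc.prems(2) by simp
  have rs: "{r, s} \<in> pairs ?R" and sub: "{r, s} \<subseteq> ?R" and NR: "N \<in> ?R"
    using Suc.prems by (simp_all add: pairs_def)
  show ?case
  proof (cases "k = Suc i")
    case True
    let ?g = "\<lambda>x. count {T \<in> ext N i (join (Suc i) {x, N} E). chain_pair T r s}"
    have "count {T \<in> ext N (Suc i) E. chain_pair T r s \<and> (k, N) \<in> T} = (\<Sum>x \<in> ?R - {N}. ?g x)"
      unfolding True by (rule count_parent_split[OF E NR])
    \<comment> \<open>The partner of \<open>N\<close> below \<open>k\<close> cannot be
      \<open>r\<close> or \<open>s\<close>, which are promised to each other.\<close>
    also have "\<dots> = (\<Sum>x \<in> ?R - {r, s, N}. ?g x)"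
    proof (rule sum.mono_neutral_right)
      show "\<forall>x \<in> ?R - {N} - (?R - {r, s, N}). ?g x = 0"
      proof (rule ballI, rule empty_countI, rule notI)
        fix x T assume x: "x \<in> ?R - {N} - (?R - {r, s, N})"
          and T: "T \<in> ext N i (join (Suc i) {x, N} E)" "chain_pair T r s"
        have "{x, N} \<inter> {r, s} \<noteq> {}" using x by blast
        from chain_pair_join(1)[OF T(1) E T(2) this] have "N \<in> {r, s}" by blast
        with Suc.prems show False by simp
      qed
    qed auto
    also have "\<dots> = (\<Sum>x \<in> ?R - {r, s, N}. pair_val i h)"
    proof (rule sum.cong[OF refl])
      fix x assume x: "x \<in> ?R - {r, s, N}"
      then have xN: "{x, N} \<in> pairs ?R" and sub': "{x, N} \<subseteq> ?R" using NR by (simp_all add: pairs_def)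
      show "?g x = pair_val i h"
      proof (rule count_chain_pair[OF forest_join[OF E N xN]])
        show "card (roots N i (join (Suc i) {x, N} E)) = h + 2"
          using card_roots_join(1)[OF E N xN] Suc.prems(6) by simp
        show "r \<in> roots N i (join (Suc i) {x, N} E)" "s \<in> roots N i (join (Suc i) {x, N} E)"
          unfolding roots_join[OF E N sub'] using x Suc.prems by auto
      qed (rule Suc.prems)
    qed
    also have "\<dots> = of_nat h * pair_val i h"
      using Suc.prems by (simp add: card_Diff_subset)
    finally show ?thesis using True by (simp add: open_val_def open_start_def pair_val_def)
  next
    case False
    then have k: "k \<le> i" using Suc.prems by simp
    let ?f = "\<lambda>h. open_val k (i - k) (Suc h)"
    let ?g = "\<lambda>S. count {T \<in> ext N i (join (Suc i) S E). chain_pair T r s \<and> (k, N) \<in> T}"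
    let ?E = "join (Suc i) {r, s} E"
    note R' = roots_join[OF E N sub]
    have E': "forest N i ?E" by (rule forest_join[OF E N rs])
    have card': "card (roots N i ?E) = h + 2"
      using card_roots_join(1)[OF E N rs] Suc.prems(6) by simp
    have c: "Suc i \<notin> ?R" by (simp add: roots_def)
    have c': "Suc i \<in> roots N i ?E" and NR': "N \<in> roots N i ?E"
      unfolding R' using NR Suc.prems by simp_all
    have "count {T \<in> ext N (Suc i) E. chain_pair T r s \<and> (k, N) \<in> T} = step ?f h +
      (\<Sum>S \<in> pairs ?R - pairs (?R - {r, s, N}). ?g S)"
      using Suc.prems k by (intro count_step_reserved[OF E N] Suc.IH) simp_all
    \<comment> \<open>Since \<open>k\<close> is unread, \<open>N\<close> must not be joined, and
      only the join of \<open>r\<close> and \<open>s\<close> survives.\<close>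
    also have "(\<Sum>S \<in> pairs ?R - pairs (?R - {r, s, N}). ?g S) = ?g {r, s}"
    proof (rule sum_eq_single)
      show "{r, s} \<in> pairs ?R - pairs (?R - {r, s, N})" using rs by (simp add: pairs_def)
      fix S assume S: "S \<in> pairs ?R - pairs (?R - {r, s, N})" "S \<noteq> {r, s}"
      show "?g S = 0"
      proof (rule empty_countI, rule notI)
        fix T assume T: "T \<in> ext N i (join (Suc i) S E)" "chain_pair T r s \<and> (k, N) \<in> T"
        have "N \<notin> S" using parent_conflict[OF T(1), of k] T(2) False by blast
        then have "S \<inter> {r, s} \<noteq> {}" using notin_pairs_Diff[OF S(1)] by blast
        with chain_pair_join(1)[OF T(1) E] T(2) S(2) show False by blast
      qed
    qed simp
    also have "{T \<in> ext N i ?E. chain_pair T r s \<and> (k, N) \<in> T}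
        = {T \<in> ext N i ?E. Suc i \<in> chain T \<and> (k, N) \<in> T}"
      using chain_pair_join_iff[OF _ E] by (intro Collect_cong conj_cong refl)
    also have "count \<dots> = (\<Sum>s' \<in> roots N i ?E - {Suc i}.
        count {T \<in> ext N i ?E. chain_pair T (Suc i) s' \<and> (k, N) \<in> T})"
      using Suc.prems k by (intro count_chain[OF c']) simp
    also have "roots N i ?E - {Suc i} = insert N (?R - {r, s, N})"
      unfolding R' using NR Suc.prems c by auto
    also have "(\<Sum>s' \<in> insert N (?R - {r, s, N}).
          count {T \<in> ext N i ?E. chain_pair T (Suc i) s' \<and> (k, N) \<in> T})
        = count {T \<in> ext N i ?E. chain_pair T (Suc i) N \<and> (k, N) \<in> T}
          + (\<Sum>s' \<in> ?R - {r, s, N}. count {T \<in> ext N i ?E. chain_pair T (Suc i) s' \<and> (k, N) \<in> T})"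
      by (rule sum.insert) simp_all
    also have "count {T \<in> ext N i ?E. chain_pair T (Suc i) N \<and> (k, N) \<in> T} = max_pair_val k i h"
      using card' Suc.prems k NR c by (intro count_chain_pair_max[OF E' c' NR']) auto
    also have "(\<Sum>s' \<in> ?R - {r, s, N}. count {T \<in> ext N i ?E. chain_pair T (Suc i) s' \<and> (k, N) \<in> T})
        = (\<Sum>s' \<in> ?R - {r, s, N}. ?f (h - 1))"
    proof (rule sum.cong[OF refl])
      fix s' assume s': "s' \<in> ?R - {r, s, N}"
      have "card (?R - {r, s, N}) = h" using Suc.prems by (simp add: card_Diff_subset)
      moreover have "card (?R - {r, s, N}) \<noteq> 0" using s' by auto
      ultimately have "h \<ge> 1" by simp
      show "count {T \<in> ext N i ?E. chain_pair T (Suc i) s' \<and> (k, N) \<in> T} = ?f (h - 1)"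
      proof (rule Suc.IH[OF E'])
        show "card (roots N i ?E) = h - 1 + 3" using card' \<open>h \<ge> 1\<close> by simp
        show "{Suc i, s', N} \<subseteq> roots N i ?E" unfolding R' using s' NR Suc.prems by auto
        show "Suc i \<noteq> s'" "Suc i \<noteq> N" "s' \<noteq> N" using s' c NR by auto
      qed (use Suc.prems k in simp_all)
    qed
    also have "\<dots> = of_nat h * ?f (h - 1)"
      using Suc.prems by (simp add: card_Diff_subset)
    finally show ?thesis
      unfolding Suc_diff_le[OF k] open_val_Suc max_pair_val_def by simp
  qed
qed simp

section \<open>Joint counts of the chain end and the parent of \<open>N\<close>\<close>

definition ends :: "(nat \<times> nat) set \<Rightarrow> nat \<Rightarrow> bool" where
  "ends T m \<longleftrightarrow> m \<in> chain T \<and> T `` {m} = {}"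

text \<open>Labels above \<open>m\<close> are unrestricted and contribute \<open>step\<close> each;
  then \<open>m\<close> is added as a leaf on the chain beside the current roots.\<close>

lemma count_ends:
  assumes "forest N i E" "i \<le> N" "card (roots N i E) = h" "1 \<le> m" "m \<le> i"
  shows "count {T \<in> ext N i E. ends T m} = (step ^^ (i - m)) (branch (m - 1)) h"
  using assms
proof (induction i arbitrary: E h)
  case (Suc i)
  note E = Suc.prems(1) and N = Suc.prems(2)
  let ?R = "roots N (Suc i) E"
  show ?case
  proof (cases "m = Suc i")
    case True
    have "{T \<in> ext N (Suc i) E. ends T m} = {T \<in> ext N i E. Suc i \<in> chain T}"
      unfolding ext_leaf[OF E] ends_def True by blast
    moreover have "count {T \<in> ext N i E. Suc i \<in> chain T} = branch i h"
      by (rule count_chain_top[OF forest_leaf[OF E]])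
        (use Suc.prems(3) in \<open>simp_all add: roots_leaf[OF E N] card_roots_leaf[OF E N, unfolded roots_leaf[OF E N]]\<close>)
    ultimately show ?thesis using True by simp
  next
    case False
    then have m: "m \<le> i" using Suc.prems by simp
    have "count {T \<in> ext N (Suc i) E. ends T m} = step ((step ^^ (i - m)) (branch (m - 1))) h +
      (\<Sum>S \<in> pairs ?R - pairs (?R - {}). count {T \<in> ext N i (join (Suc i) S E). ends T m})"
      using Suc.prems m by (intro count_step_reserved[OF E N] Suc.IH) simp_all
    then show ?thesis by (simp add: Suc_diff_le[OF m])
  qed
qed simp

lemma count_step_max:
  assumes E: "forest N (Suc i) E" and N: "N \<in> roots N (Suc i) E"
    and h: "card (roots N (Suc i) E) = Suc h" and k: "k \<noteq> Suc i"
    and IH: "\<And>E' h'. forest N i E' \<Longrightarrow> N \<in> roots N i E' \<Longrightarrow> card (roots N i E') = Suc h' \<Longrightarrow>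
      count {T \<in> ext N i E'. P T \<and> (k, N) \<in> T} = f h'"
  shows "count {T \<in> ext N (Suc i) E. P T \<and> (k, N) \<in> T} = step f h"
proof -
  let ?R = "roots N (Suc i) E"
  have "Suc i \<le> N" using roots_le[OF N] by simp
  then have "count {T \<in> ext N (Suc i) E. P T \<and> (k, N) \<in> T} = step f h +
      (\<Sum>S \<in> pairs ?R - pairs (?R - {N}). count {T \<in> ext N i (join (Suc i) S E). P T \<and> (k, N) \<in> T})"
    using N h by (intro count_step_reserved[OF E] IH) simp_all
  also have "(\<Sum>S \<in> pairs ?R - pairs (?R - {N}).
      count {T \<in> ext N i (join (Suc i) S E). P T \<and> (k, N) \<in> T}) = 0"
  proof (rule sum.neutral, rule ballI, rule empty_countI, rule notI)
    fix S T assume S: "S \<in> pairs ?R - pairs (?R - {N})"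
      and T: "T \<in> ext N i (join (Suc i) S E)" "P T \<and> (k, N) \<in> T"
    have "N \<in> S" using notin_pairs_Diff[OF S] by simp
    with parent_conflict[OF T(1), of k] T(2) k show False by simp
  qed
  finally show ?thesis by simp
qed

text \<open>Here \<open>k\<close> is read before \<open>m\<close>. It joins \<open>N\<close> to one
  of the \<open>h\<close> other roots, hence \<open>euler\<close>, and afterwards only the chain end
  is prescribed.\<close>

lemma count_ends_less:
  assumes "forest N i E" "N \<in> roots N i E" "card (roots N i E) = Suc h" "1 \<le> m" "m < k" "k \<le> i"
  shows "count {T \<in> ext N i E. ends T m \<and> (k, N) \<in> T}
    = (step ^^ (i - k)) (euler ((step ^^ (k - 1 - m)) (branch (m - 1)))) h"
  using assms
proof (induction i arbitrary: E h)
  case (Suc i)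
  note E = Suc.prems(1) and NR = Suc.prems(2)
  let ?R = "roots N (Suc i) E"
  have N: "Suc i \<le> N" using roots_le[OF NR] by simp
  show ?case
  proof (cases "k = Suc i")
    case True
    let ?v = "(step ^^ (i - m)) (branch (m - 1)) h"
    have "count {T \<in> ext N (Suc i) E. ends T m \<and> (k, N) \<in> T} =
        (\<Sum>x \<in> ?R - {N}. count {T \<in> ext N i (join (Suc i) {x, N} E). ends T m})"
      unfolding True by (rule count_parent_split[OF E NR])
    also have "\<dots> = (\<Sum>x \<in> ?R - {N}. ?v)"
    proof (rule sum.cong[OF refl])
      fix x assume "x \<in> ?R - {N}"
      then have xN: "{x, N} \<in> pairs ?R" using NR by (simp add: pairs_def)
      show "count {T \<in> ext N i (join (Suc i) {x, N} E). ends T m} = ?v"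
        using card_roots_join(1)[OF E N xN] Suc.prems True N
        by (intro count_ends[OF forest_join[OF E N xN]]) simp_all
    qed
    also have "\<dots> = of_nat h * ?v" using Suc.prems by simp
    finally show ?thesis using True by (simp add: euler_def)
  next
    case False
    then have k: "k \<le> i" using Suc.prems by simp
    show ?thesis unfolding Suc_diff_le[OF k] funpow.simps comp_apply
      using Suc.prems k False by (intro count_step_max[OF E] Suc.IH) simp_all
  qed
qed simp

text \<open>Here the leaf \<open>m\<close> is read first. Its sibling is \<open>N\<close> or one of
  \<open>h\<close> other roots; the latter leaves \<open>h - 1\<close> free roots, and the offset in
  \<open>open_val\<close> restores the argument \<open>h\<close>.\<close>

lemma count_ends_greater:
  assumes "forest N i E" "N \<in> roots N i E" "card (roots N i E) = Suc h" "1 \<le> k" "k < m" "m \<le> i"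
  shows "count {T \<in> ext N i E. ends T m \<and> (k, N) \<in> T}
    = (step ^^ (i - m)) (\<lambda>h. euler (open_val k (m - 1 - k)) h + max_pair_val k (m - 1) h) h"
  using assms
proof (induction i arbitrary: E h)
  case (Suc i)
  note E = Suc.prems(1) and NR = Suc.prems(2)
  let ?R = "roots N (Suc i) E"
  have N: "Suc i \<le> N" using roots_le[OF NR] by simp
  show ?case
  proof (cases "m = Suc i")
    case True
    note R' = roots_leaf[OF E N] and E' = forest_leaf[OF E]
    have c: "Suc i \<notin> ?R" by (simp add: roots_def)
    have card': "card (roots N i E) = h + 2" using card_roots_leaf[OF E N] Suc.prems(3) by simp
    let ?g = "\<lambda>s. count {T \<in> ext N i E. chain_pair T (Suc i) s \<and> (k, N) \<in> T}"
    have "{T \<in> ext N (Suc i) E. ends T m \<and> (k, N) \<in> T} = {T \<in> ext N i E. Suc i \<in> chain T \<and> (k, N) \<in> T}"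
      unfolding ext_leaf[OF E] ends_def True by blast
    then have "count {T \<in> ext N (Suc i) E. ends T m \<and> (k, N) \<in> T} =
        count {T \<in> ext N i E. Suc i \<in> chain T \<and> (k, N) \<in> T}" by simp
    also have "\<dots> = (\<Sum>s \<in> roots N i E - {Suc i}. ?g s)"
      using Suc.prems True by (intro count_chain) (simp_all add: R')
    also have "roots N i E - {Suc i} = insert N (?R - {N})"
      unfolding R' using NR c by auto
    also have "sum ?g (insert N (?R - {N})) = ?g N + (\<Sum>s \<in> ?R - {N}. ?g s)"
      by (rule sum.insert) simp_all
    also have "?g N = max_pair_val k i h"
      using E' card' Suc.prems True NR c by (intro count_chain_pair_max) (auto simp: R')
    also have "(\<Sum>s \<in> ?R - {N}. ?g s) = (\<Sum>s \<in> ?R - {N}. open_val k (i - k) (Suc (h - 1)))"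
    proof (rule sum.cong[OF refl])
      fix s assume s: "s \<in> ?R - {N}"
      have "card (?R - {N}) = h" using Suc.prems by simp
      moreover have "card (?R - {N}) \<noteq> 0" using s by auto
      ultimately have "h \<ge> 1" by simp
      show "?g s = open_val k (i - k) (Suc (h - 1))"
      proof (rule count_chain_pair_open[OF E'])
        show "card (roots N i E) = h - 1 + 3" using card' \<open>h \<ge> 1\<close> by simp
        show "{Suc i, s, N} \<subseteq> roots N i E" unfolding R' using s NR by auto
        show "Suc i \<noteq> s" "Suc i \<noteq> N" "s \<noteq> N" using s c NR by auto
      qed (use Suc.prems True in simp_all)
    qed
    \<comment> \<open>\<open>Suc (h - 1)\<close> differs from \<open>h\<close> only at 0, where the
      factor \<open>h\<close> vanishes.\<close>
    also have "\<dots> = euler (open_val k (i - k)) h"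
      using Suc.prems by (cases h) (simp_all add: euler_def)
    finally show ?thesis using True by simp
  next
    case False
    then have m: "m \<le> i" using Suc.prems by simp
    show ?thesis unfolding Suc_diff_le[OF m] funpow.simps comp_apply
      using Suc.prems m by (intro count_step_max[OF E] Suc.IH) simp_all
  qed
qed simp

section \<open>Symmetry of the joint distribution\<close>

definition joint :: "nat \<Rightarrow> nat \<Rightarrow> nat \<Rightarrow> nat" where
  "joint N m k = card {T \<in> trees N. ends T m \<and> (k, N) \<in> T}"

text \<open>The largest label is a leaf, so reading starts with it as the only root; the counts are
  then evaluated at 0 further roots.\<close>

lemma trees_eq_ext: "trees (Suc M) = ext (Suc M) M {}"
proof -
  have "{e \<in> T. M < fst e} = {}" if "T \<in> trees (Suc M)" for T
  proof -
    have F: "forest (Suc M) 0 T" using that by (simp add: trees_def)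
    have "\<not> M < u" if "(u, v) \<in> T" for u v
      using forestD(2,3)[OF F that] by simp
    then show ?thesis by auto
  qed
  then show ?thesis by (auto simp: ext_def)
qed

lemma forest_empty: "forest N i {}"
  by (simp add: forest_def)

lemma roots_top: "roots (Suc M) M {} = {Suc M}"
  by (auto simp: roots_def)

lemma joint_less:
  assumes "1 \<le> m" "m < k" "k \<le> M"
  shows "of_nat (joint (Suc M) m k) = (step ^^ (M - k)) (euler ((step ^^ (k - 1 - m)) (branch (m - 1)))) 0"
  unfolding joint_def trees_eq_ext
  using assms by (intro count_ends_less[OF forest_empty]) (simp_all add: roots_top)

lemma joint_greater:
  assumes "1 \<le> k" "k < m" "m \<le> M"
  shows "of_nat (joint (Suc M) m k)
    = (step ^^ (M - m)) (\<lambda>h. euler (open_val k (m - 1 - k)) h + max_pair_val k (m - 1) h) 0"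
  unfolding joint_def trees_eq_ext
  using assms by (intro count_ends_greater[OF forest_empty]) (simp_all add: roots_top)

text \<open>The chain end has no child, whereas \<open>k\<close> has the child
  \<open>N\<close>.\<close>

lemma joint_diag: "joint N k k = 0"
  by (auto simp: joint_def ends_def)

section \<open>Evaluation by the inner product and reflection\<close>

lemma step_zero: "step (\<lambda>h. 0) = (\<lambda>h. 0)"
  by (simp add: step_def fun_eq_iff)

lemma step_pow_zero: "(step ^^ a) (\<lambda>h. 0) = (\<lambda>h. 0)"
  by (induction a) (simp_all add: step_zero)

lemma step_unit_0: "step (unit 0) = (\<lambda>h. 0)"
proof
  fix h :: nat
  have "h choose 2 = 0" if "h - 1 = 0"
    using that by (simp add: binomial_eq_0)
  then show "step (unit 0) h = 0" by (simp add: step_def unit_def)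
qed

lemma step_pow_unit_0: "(step ^^ Suc a) (unit 0) = (\<lambda>h. 0)"
  unfolding step_pow_Suc step_unit_0 step_pow_zero ..

text \<open>\<open>inner\<close> does not see values at 0; one power of \<open>step\<close> is spent
  on moving the evaluation to 1.\<close>

lemma step_pow_Suc_0: "(step ^^ Suc p) f 0 = (step ^^ p) f 1"
  by (simp add: step_def binomial_eq_0)

lemma step_pow_at_1:
  assumes "fin_supp f" shows "(step ^^ p) f 1 = inner ((step ^^ p) (unit 1)) f"
proof -
  have "(step ^^ p) f 1 = inner (unit (Suc 0)) ((step ^^ p) f)" by (simp add: inner_unit)
  also have "\<dots> = inner ((step ^^ p) (unit 1)) f"
    using assms by (simp add: inner_step_pow fin_supp_unit)
  finally show ?thesis .
qed

lemma fin_supp_mid: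
  assumes "fin_supp f" shows "fin_supp (mid a f)"
proof -
  have add: "fin_supp (\<lambda>h. f h + g h)" and diff: "fin_supp (\<lambda>h. f h - g h)"
    if fg: "fin_supp f" "fin_supp g" for f g
  proof -
    obtain M M' where "\<forall>h\<ge>M. f h = 0" "\<forall>h\<ge>M'. g h = 0" using fg unfolding fin_supp_def by blast
    then have "\<forall>h\<ge>max M M'. f h + g h = 0" "\<forall>h\<ge>max M M'. f h - g h = 0" by simp_all
    then show "fin_supp (\<lambda>h. f h + g h)" "fin_supp (\<lambda>h. f h - g h)" unfolding fin_supp_def by blast+
  qed
  show ?thesis
  proof (cases a)
    case 0
    then show ?thesis using assms by (simp add: mid_0 fin_supp_euler)
  next
    case (Suc b)
    show ?thesis unfolding Suc mid_Suc
      by (intro add diff fin_supp_euler fin_supp_up fin_supp_down fin_supp_step_pow assms)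
  qed
qed

abbreviation walk :: "nat \<Rightarrow> weight" where
  "walk q \<equiv> (step ^^ q) (unit 1)"

lemma fin_supp_walk: "fin_supp (walk q)"
  by (intro fin_supp_step_pow fin_supp_unit)

lemma joint_less_inner:
  assumes "2 \<le> m" "m < k" "k < M"
  shows "of_nat (joint (Suc M) m k) = inner (walk (M - 1 - k)) (euler ((step ^^ (k - 1 - m)) (euler (walk (m - 2)))))"
proof -
  have b: "branch (m - 1) = euler (walk (m - 2))"
    using assms by (simp add: branch_def numeral_2_eq_2)
  have "M - k = Suc (M - 1 - k)" using assms by simp
  then have "of_nat (joint (Suc M) m k)
      = (step ^^ (M - 1 - k)) (euler ((step ^^ (k - 1 - m)) (euler (walk (m - 2))))) 1"
    using joint_less[of m k M] assms by (simp only: b step_pow_Suc_0)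
  then show ?thesis
    by (simp only: step_pow_at_1 fin_supp_euler fin_supp_step_pow fin_supp_walk)
qed

text \<open>The root is no leaf here. This boundary case and \<open>joint_less_max\<close>, where
  \<open>M\<close> has just one larger label, are exchanged by the reflection.\<close>

lemma joint_less_one: "1 < k \<Longrightarrow> k \<le> M \<Longrightarrow> joint (Suc M) 1 k = 0"
proof -
  assume k: "1 < k" "k \<le> M"
  have "euler ((step ^^ a) (unit 0)) = (\<lambda>h. 0)" for a
    by (cases a) (simp_all only: step_pow_unit_0, simp_all add: euler_def unit_def fun_eq_iff)
  then have "(of_nat (joint (Suc M) 1 k) :: rat) = 0"
    using joint_less[of 1 k M] k by (simp add: branch_def step_pow_zero)
  then show ?thesis by simp
qed

lemma joint_less_max: "1 \<le> m \<Longrightarrow> m < M \<Longrightarrow> joint (Suc M) m M = 0"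
proof -
  assume m: "1 \<le> m" "m < M"
  then have "(of_nat (joint (Suc M) m M) :: rat) = 0"
    using joint_less[of m M M] by (simp add: euler_def)
  then show ?thesis by simp
qed

lemma joint_less_sym:
  assumes "1 \<le> m" "m < k" "k \<le> M"
  shows "joint (Suc M) m k = joint (Suc M) (Suc M - k) (Suc M - m)"
proof -
  consider "m = 1" | "k = M" | "2 \<le> m" "k < M" using assms by linarith
  then show ?thesis
  proof cases
    case 1
    then show ?thesis using assms joint_less_one[of k M] joint_less_max[of "Suc M - k" M] by simp
  next
    case 2
    then show ?thesis using assms joint_less_max[of m M] joint_less_one[of "Suc M - m" M] by simp
  next
    case 3
    have "M - 1 - (Suc M - m) = m - 2" "Suc M - m - 1 - (Suc M - k) = k - 1 - m" "Suc M - k - 2 = M - 1 - k"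
      using 3 assms by simp_all
    then have "of_nat (joint (Suc M) (Suc M - k) (Suc M - m))
      = inner (walk (m - 2)) (euler ((step ^^ (k - 1 - m)) (euler (walk (M - 1 - k)))))"
      using joint_less_inner[of "Suc M - k" "Suc M - m" M] 3 assms by simp
    also have "\<dots> = of_nat (joint (Suc M) m k)"
      using joint_less_inner[of m k M] 3 assms
        inner_euler_step_pow_euler[OF fin_supp_walk fin_supp_walk, of "M - 1 - k" "k - 1 - m" "m - 2"] by simp
    finally show ?thesis by simp
  qed
qed

text \<open>With w = \<open>walk (k - 2)\<close>, the recursion for \<open>open_val\<close> starts
  at \<theta> w - w and is fed by \<theta> w.\<close>

lemma mid_eq_open_val:
  assumes "2 \<le> k" "k < m"
  shows "(\<lambda>h. euler (open_val k (m - 1 - k)) h + max_pair_val k (m - 1) h) = mid (m - 1 - k) (walk (k - 2))"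
proof -
  have b: "branch (k - 1) = euler (walk (k - 2))"
    using assms by (simp add: branch_def numeral_2_eq_2)
  have s: "open_start k = (\<lambda>h. euler (walk (k - 2)) h - walk (k - 2) h)"
    using assms by (auto simp: open_start_def euler_def algebra_simps fun_eq_iff)
  show ?thesis unfolding mid_def[abs_def] open_val_def max_pair_val_def b s
    by (simp add: euler_def open_val_def[abs_def] b s algebra_simps)
qed

lemma joint_greater_inner:
  assumes "2 \<le> k" "k < m" "m < M"
  shows "of_nat (joint (Suc M) m k) = inner (walk (M - 1 - m)) (mid (m - 1 - k) (walk (k - 2)))"
proof -
  have "M - m = Suc (M - 1 - m)" using assms by simp
  then have "of_nat (joint (Suc M) m k) = (step ^^ (M - 1 - m)) (mid (m - 1 - k) (walk (k - 2))) 1"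
    using joint_greater[of k m M] assms by (simp only: mid_eq_open_val step_pow_Suc_0)
  then show ?thesis by (simp only: step_pow_at_1 fin_supp_mid fin_supp_walk)
qed

text \<open>\<open>unit 0\<close> is the constant 1: \<open>step\<close> kills it and
  \<open>shift\<close> turns it into \<open>unit 1\<close>, so only the j = 0 term of the sum
  survives.\<close>

lemma shift_sum_unit_0: "shift_sum (Suc a) (unit 0) = walk a"
proof (induction a)
  case 0
  show ?case by (auto simp: step_zero shift_def unit_def fun_eq_iff)
next
  case (Suc a)
  have "shift_sum (Suc (Suc a)) (unit 0) = (\<lambda>h. step (shift_sum (Suc a) (unit 0)) h + shift ((step ^^ Suc a) (unit 0)) h)"
    by (rule shift_sum.simps(2))
  then show ?case unfolding Suc step_pow_unit_0 by (simp add: shift_def)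
qed

lemma joint_greater_boundary:
  assumes "2 \<le> k" "k < M"
  shows "joint (Suc M) M k = joint (Suc M) (Suc M - k) 1"
proof -
  define a where "a = M - 1 - k"
  \<comment> \<open>Evaluation at 0 kills the terms of \<open>mid\<close> with an outer
    \<open>euler\<close>.\<close>
  have L: "of_nat (joint (Suc M) M k) = (step ^^ a) (euler (walk (k - 2))) 0"
    using joint_greater[of k M M] assms unfolding a_def
    by (simp only: mid_eq_open_val) (simp add: mid_def euler_def[of _ 0])
  have open_val_1: "open_start 1 = (\<lambda>h. 0)" by (simp add: open_start_def fun_eq_iff)
  have m': "M - (Suc M - k) = Suc (k - 2)" "Suc M - k - 1 - 1 = a" "Suc M - k - 1 = Suc a"
    using assms by (auto simp: a_def)
  have "of_nat (joint (Suc M) (Suc M - k) 1)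
      = (step ^^ Suc (k - 2)) (\<lambda>h. euler (open_val 1 a) h + (step ^^ a) (unit 0) h) 0"
    using joint_greater[of 1 "Suc M - k" M, unfolded m'] assms
    by (simp add: max_pair_val_def branch_def del: funpow.simps)
  also have "\<dots> = (step ^^ a) (euler (walk (k - 2))) 0"
  proof (cases a)
    case 0
    have "open_val 1 0 = (\<lambda>h. 0)" unfolding open_val_def[abs_def] open_val_1 by simp
    then have "(\<lambda>h. euler (open_val 1 a) h + (step ^^ a) (unit 0) h) = unit 0"
      by (simp add: 0 euler_def)
    then show ?thesis unfolding 0 by (simp only: step_pow_unit_0) (simp add: euler_def)
  next
    case (Suc b)
    have "open_val 1 (Suc b) = walk b"
      unfolding open_val_def[abs_def] open_val_1 step_pow_zero
      by (simp only: branch_def diff_self_eq_0 refl if_True shift_sum_unit_0 add_0)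
    then have "(\<lambda>h. euler (open_val 1 a) h + (step ^^ a) (unit 0) h) = euler (walk b)"
      unfolding Suc step_pow_unit_0 by simp
    then have "(step ^^ Suc (k - 2)) (\<lambda>h. euler (open_val 1 a) h + (step ^^ a) (unit 0) h) 0
        = inner (walk (k - 2)) (euler (walk b))"
      by (simp only: step_pow_Suc_0 step_pow_at_1 fin_supp_euler fin_supp_walk)
    also have "\<dots> = inner (euler (walk (k - 2))) (walk b)"
      by (rule inner_euler[OF fin_supp_walk])
    also have "\<dots> = inner (walk b) (euler (walk (k - 2)))"
      by (intro inner_commute fin_supp_euler fin_supp_walk)
    also have "\<dots> = (step ^^ a) (euler (walk (k - 2))) 0"
      unfolding Suc step_pow_Suc_0 by (simp only: step_pow_at_1 fin_supp_euler fin_supp_walk)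
    finally show ?thesis .
  qed
  finally show ?thesis using L by simp
qed

lemma joint_greater_sym:
  assumes "1 \<le> k" "k < m" "m \<le> M"
  shows "joint (Suc M) m k = joint (Suc M) (Suc M - k) (Suc M - m)"
proof -
  \<comment> \<open>The first case is fixed by the reflection; the next two are mirror images of
    each other.\<close>
  consider "k = 1" "m = M" | "k = 1" "m < M" | "2 \<le> k" "m = M" | "2 \<le> k" "m < M"
    using assms by linarith
  then show ?thesis
  proof cases
    case 2
    then show ?thesis using assms joint_greater_boundary[of "Suc M - m" M] by simp
  next
    case 3
    then show ?thesis using assms joint_greater_boundary[of k M] by simp
  next
    case 4
    have "M - 1 - (Suc M - k) = k - 2" "Suc M - k - 1 - (Suc M - m) = m - 1 - k" "Suc M - m - 2 = M - 1 - m"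
      using 4 assms by simp_all
    then have "of_nat (joint (Suc M) (Suc M - k) (Suc M - m))
      = inner (walk (k - 2)) (mid (m - 1 - k) (walk (M - 1 - m)))"
      using joint_greater_inner[of "Suc M - m" "Suc M - k" M] 4 assms by simp
    also have "\<dots> = of_nat (joint (Suc M) m k)"
      using joint_greater_inner[of k m M] 4 assms
        inner_mid[OF fin_supp_walk fin_supp_walk, of "k - 2" "m - 1 - k" "M - 1 - m"] by simp
    finally show ?thesis by simp
  qed simp
qed

lemma joint_sym:
  assumes "m \<in> {1..M}" "k \<in> {1..M}"
  shows "joint (Suc M) m k = joint (Suc M) (Suc M - k) (Suc M - m)"
  using assms joint_less_sym[of m k M] joint_greater_sym[of k m M]
  by (cases m k rule: linorder_cases) (auto simp: joint_diag)

section \<open>Translation to the given trees and statistics\<close>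

lemma so_binary_trees_eq:
  assumes "1 \<le> N" shows "so_binary_trees N = trees N"
proof (intro set_eqI iffI)
  have Icc: "{1..N} = {0<..N}" by auto
  fix T
  {
    assume "T \<in> so_binary_trees N"
    then have T: "T \<subseteq> {0<..N} \<times> {0<..N}" "\<And>u. (u, 1) \<notin> T" "\<And>v. v \<in> {0<..N} - {1} \<Longrightarrow> \<exists>!u. (u, v) \<in> T"
        "\<And>v. v \<in> {0<..N} \<Longrightarrow> T `` {v} = {} \<or> card (T `` {v}) = 2" "\<And>u v. (u, v) \<in> T\<^sup>+ \<Longrightarrow> u < v"
      unfolding so_binary_trees_def rooted_tree_def Icc by blast+
    have "u = u'" if "(u, v) \<in> T" "(u', v) \<in> T" for u u' v
    proof -
      have "v \<in> {0<..N} - {1}" using that(1) T(1,2) by blast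
      from T(3)[OF this] that show ?thesis by blast
    qed
    moreover have "T `` {u} = {} \<or> card (T `` {u}) = 2" for u
      using T(1) T(4)[of u] by blast
    ultimately have "forest N 0 T"
      unfolding forest_def using T(1,5) by blast
    moreover have "roots N 0 T = {1}"
    proof (intro set_eqI iffI)
      fix v assume v: "v \<in> roots N 0 T"
      show "v \<in> {1}"
      proof (rule ccontr)
        assume "v \<notin> {1}"
        with v have "v \<in> {0<..N} - {1}" by (simp add: roots_def)
        from T(3)[OF this] v show False by (auto simp: roots_def)
      qed
    next
      fix v assume "v \<in> {1::nat}"
      then show "v \<in> roots N 0 T" using assms T(2) by (auto simp: roots_def)
    qed
    ultimately show "T \<in> trees N" by (simp add: trees_def)
  }
  assume "T \<in> trees N"
  then have F: "forest N 0 T" and R: "roots N 0 T = {1}" by (simp_all add: trees_def)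
  have sub: "T \<subseteq> {1..N} \<times> {1..N}" using F unfolding forest_def Icc by blast
  have "1 \<in> roots N 0 T" using R by simp
  then have no1: "(u, 1) \<notin> T" for u by (auto simp: roots_def)
  have parent: "\<exists>u. (u, v) \<in> T" if "v \<in> {1..N} - {1}" for v
  proof -
    have "v \<notin> roots N 0 T" using R that by simp
    then show ?thesis using that by (auto simp: roots_def)
  qed
  have uniq: "\<exists>!u. (u, v) \<in> T" if "v \<in> {1..N} - {1}" for v
    using parent[OF that] forestD(4)[OF F, of _ v] by blast
  have reach: "(1, v) \<in> T\<^sup>*" if "v \<in> {1..N}" for v
    using that
  proof (induction v rule: less_induct)
    case (less v)
    show ?case
    proof (cases "v = 1")
      case False
      then obtain u where u: "(u, v) \<in> T" using parent[of v] less.prems by blast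
      then have "u \<in> {1..N}" using sub by blast
      then have "(1, u) \<in> T\<^sup>*" using less.IH forestD(3)[OF F u] by blast
      then show ?thesis using u by (rule rtrancl_into_rtrancl)
    qed simp
  qed
  have "u < v" if "(u, v) \<in> T\<^sup>+" for u v
    using that
  proof (induction rule: trancl_induct)
    case (base v)
    then show ?case by (rule forestD(3)[OF F])
  next
    case (step v w)
    then show ?case using forestD(3)[OF F step(2)] by simp
  qed
  then show "T \<in> so_binary_trees N"
    unfolding so_binary_trees_def rooted_tree_def
    using assms sub no1 uniq reach forestD(5)[OF F] by simp
qed

lemma eoc_ends:
  assumes "T \<in> trees N" "1 \<le> N" shows "ends T (eoc T)"
proof -
  have F: "forest N 0 T" using assms by (simp add: trees_def)
  have child: "v < Min (T `` {v}) \<and> Min (T `` {v}) \<le> N \<and> Min (T `` {v}) \<in> chain T"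
    if v: "v \<in> chain T" "T `` {v} \<noteq> {}" for v
  proof -
    have "T `` {v} \<subseteq> {..N}" using forestD(2)[OF F, of v] by auto
    then have "finite (T `` {v})" by (rule finite_subset) simp
    from Min_in[OF this v(2)] have c: "(v, Min (T `` {v})) \<in> T" by simp
    have "(v, Min (T `` {v})) \<in> min_child T" using v(2) by (simp add: min_child_def)
    moreover have "(1, v) \<in> (min_child T)\<^sup>*" using v(1) by (simp add: chain_def)
    ultimately have "Min (T `` {v}) \<in> chain T" by (simp add: chain_def rtrancl_into_rtrancl)
    then show ?thesis using forestD(2,3)[OF F c] by simp
  qed
  show ?thesis unfolding eoc_def
  proof (rule while_rule[where P = "\<lambda>v. v \<in> chain T \<and> v \<le> N" and r = "measure (\<lambda>v. N - v)"])
    show "1 \<in> chain T \<and> 1 \<le> N" using assms(2) one_in_chain by simp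
  next
    fix v assume "v \<in> chain T \<and> v \<le> N" "T `` {v} \<noteq> {}"
    then have *: "v < Min (T `` {v}) \<and> Min (T `` {v}) \<le> N \<and> Min (T `` {v}) \<in> chain T"
      by (intro child) simp_all
    then show "Min (T `` {v}) \<in> chain T \<and> Min (T `` {v}) \<le> N" by simp
    from * show "(Min (T `` {v}), v) \<in> measure (\<lambda>v. N - v)" by (simp add: diff_less_mono2)
  qed (simp_all add: ends_def)
qed

text \<open>\<open>min_child\<close> is a partial function, so one of two chain ends is reachable
  from the other, but a leaf has no successor.\<close>

lemma ends_unique:
  assumes "ends T m" "ends T m'" shows "m = m'"
proof -
  have stop: "x = y" if "(x, y) \<in> (min_child T)\<^sup>*" "T `` {x} = {}" for x y
    using that(1)
  proof (cases rule: converse_rtranclE)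
    case (step z)
    then show ?thesis using that(2) by (simp add: min_child_def)
  qed simp
  have "single_valued (min_child T)" by (auto simp: single_valued_def min_child_def)
  moreover have "(1, m) \<in> (min_child T)\<^sup>*" "(1, m') \<in> (min_child T)\<^sup>*"
    using assms by (simp_all add: ends_def chain_def)
  ultimately have "(m, m') \<in> (min_child T)\<^sup>* \<or> (m', m) \<in> (min_child T)\<^sup>*"
    by (rule single_valued_confluent)
  then show ?thesis using stop assms by (auto simp: ends_def)
qed

lemma parent_max:
  assumes "T \<in> trees N" "2 \<le> N" shows "\<exists>!u. (u, N) \<in> T"
proof -
  have F: "forest N 0 T" and R: "roots N 0 T = {1}" using assms by (simp_all add: trees_def)
  have "N \<notin> roots N 0 T" using R assms(2) by simp
  then obtain u where "(u, N) \<in> T" using assms(2) by (auto simp: roots_def)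
  then show ?thesis using forestD(4)[OF F, of _ N] by blast
qed

lemma tree_poly_joint:
  assumes "1 \<le> n"
  shows "tree_poly n x y = (\<Sum>(m, k) \<in> {1..2 * n} \<times> {1..2 * n}.
    of_nat (joint (Suc (2 * n)) m k) * (x ^ m * y ^ (Suc (2 * n) - k)))"
proof -
  let ?N = "Suc (2 * n)"
  let ?I = "{1..2 * n} \<times> {1..2 * n}"
  let ?st = "\<lambda>T. (eoc T, pom n T)"
  have iff: "?st T = (m, k) \<longleftrightarrow> ends T m \<and> (k, ?N) \<in> T" if T: "T \<in> trees ?N" for T m k
  proof -
    have "eoc T = m \<longleftrightarrow> ends T m" using eoc_ends[OF T] ends_unique[of T "eoc T" m] by auto
    moreover have "pom n T = k \<longleftrightarrow> (k, ?N) \<in> T"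
      unfolding pom_def using parent_max[OF T] assms theI'[of "\<lambda>u. (u, ?N) \<in> T"] by auto
    ultimately show ?thesis by simp
  qed
  have range: "?st T \<in> ?I" if T: "T \<in> trees ?N" for T
  proof -
    obtain m k where mk: "?st T = (m, k)" by blast
    then have m: "ends T m" and k: "(k, ?N) \<in> T" using iff[OF T] by blast+
    have F: "forest ?N 0 T" using T by (simp add: trees_def)
    have "1 \<le> k" "k \<le> 2 * n" using forestD(1,3)[OF F k] by simp_all
    moreover have "1 \<le> m \<and> m \<le> 2 * n"
    proof -
      have "m \<in> chain T" using m by (simp add: ends_def)
      then have "(1, m) \<in> (min_child T)\<^sup>*" by (simp add: chain_def)
      then show ?thesis
      proof (cases rule: rtranclE)
        case base
        then show ?thesis using assms by simp
      next
        case (step d)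
        then have ne: "T `` {d} \<noteq> {}" and min: "m = Min (T `` {d})" by (simp_all add: min_child_def)
        then have "card (T `` {d}) = 2" using forestD(5)[OF F, of d] by simp
        \<comment> \<open>The smaller of two distinct labels up to 2n + 1 is at most 2n.\<close>
        then obtain a b where ab: "T `` {d} = {a, b}" "a \<noteq> b" unfolding card_2_iff by blast
        then have "(d, a) \<in> T" "(d, b) \<in> T" by blast+
        then have "a \<le> ?N" "b \<le> ?N" "d < a" "d < b" using forestD(2,3)[OF F] by blast+
        moreover have "m = (if a \<le> b then a else b)" unfolding min ab(1) by (simp add: min_def)
        ultimately show ?thesis using ab(2) by (auto split: if_splits)
      qed
    qed
    ultimately show ?thesis unfolding mk by simp
  qed
  have "tree_poly n x y = (\<Sum>T \<in> trees ?N. x ^ eoc T * y ^ (?N - pom n T))"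
    unfolding tree_poly_def Eoc_def Pom_def using so_binary_trees_eq[of ?N] by simp
  also have "\<dots> = (\<Sum>p \<in> ?I. \<Sum>T \<in> {T \<in> trees ?N. ?st T = p}. x ^ eoc T * y ^ (?N - pom n T))"
    using range by (intro sum.group[symmetric]) auto
  also have "\<dots> = (\<Sum>(m, k) \<in> ?I. of_nat (joint ?N m k) * (x ^ m * y ^ (?N - k)))"
  proof (rule sum.cong[OF refl], clarify)
    fix m k
    have "(\<Sum>T \<in> {T \<in> trees ?N. ?st T = (m, k)}. x ^ eoc T * y ^ (?N - pom n T))
        = (\<Sum>T \<in> {T \<in> trees ?N. ?st T = (m, k)}. x ^ m * y ^ (?N - k))"
      by (rule sum.cong) auto
    also have "\<dots> = of_nat (card {T \<in> trees ?N. ?st T = (m, k)}) * (x ^ m * y ^ (?N - k))"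
      by (rule sum_constant)
    also have "card {T \<in> trees ?N. ?st T = (m, k)} = joint ?N m k"
      unfolding joint_def using iff by (intro arg_cong[where f = card]) blast
    finally show "(\<Sum>T \<in> {T \<in> trees ?N. ?st T = (m, k)}. x ^ eoc T * y ^ (?N - pom n T))
        = of_nat (joint ?N m k) * (x ^ m * y ^ (?N - k))" .
  qed
  finally show ?thesis .
qed

theorem theorem6p2:
  fixes n :: nat and x y :: "'a::comm_semiring_1"
  assumes "n \<ge> 1"
  shows "tree_poly n x y = tree_poly n y x"
  unfolding tree_poly_joint[OF assms]
  \<comment> \<open>This involution exchanges the exponents \<open>m\<close> and
    \<open>Suc (2 * n) - k\<close>.\<close>
  by (rule sum.reindex_bij_witness[where i = "\<lambda>(m, k). (Suc (2 * n) - k, Suc (2 * n) - m)"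
        and j = "\<lambda>(m, k). (Suc (2 * n) - k, Suc (2 * n) - m)"])
    (auto simp: joint_sym mult.commute)

end
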